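(* Let $(W,S)$ be an irreducible finite Coxeter group of rank $n$ and Coxeter number $h$. Let $X_{\mathrm{des}+\mathrm{ides}}$ be the value of $\mathrm{des}(w)+\mathrm{des}(w^{-1})$ and $X_{\mathrm{des}}$ the value of $\mathrm{des}(w)$ for $w\in W$ chosen uniformly at random. Then \[ \mathbb{E}(X_{\mathrm{des}+\mathrm{ides}})=n,\qquad \mathbb{V}(X_{\mathrm{des}+\mathrm{ides}}) = 2\,\mathbb{V}(X_{\mathrm{des}})+\frac nh. \]
   Context: Fix a root system for $(W,S)$ with simple roots $\Delta$ and negative roots $\Phi^-$; $\mathrm{des}(w)=\#\{\beta\in\Delta : w(\beta)\in\Phi^-\}$. The Coxeter number $h$ is the order of a product of all simple reflections of $W$ (in any order). *)

theory Defs
  imports Complex_Main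
begin

text \<open>Coxeter matrix on a finite index type 'i (the set S of simple reflections).
  The value 0 encodes m = infinity.\<close>

definition coxeter_matrix :: "('i \<Rightarrow> 'i \<Rightarrow> nat) \<Rightarrow> bool" where
  "coxeter_matrix m \<longleftrightarrow> (\<forall>i. m i i = 1) \<and> (\<forall>i j. m i j = m j i)
     \<and> (\<forall>i j. i \<noteq> j \<longrightarrow> m i j \<noteq> 1)"

text \<open>Bilinear form of the geometric (Tits) representation: B(e_i,e_j) = - cos(pi/m_ij),
  and = -1 if m_ij = infinity.\<close>
definition cox_B :: "('i \<Rightarrow> 'i \<Rightarrow> nat) \<Rightarrow> 'i \<Rightarrow> 'i \<Rightarrow> real" where
  "cox_B m i j = (if m i j = 0 then -1 else - cos (pi / real (m i j)))"

text \<open>Simple root e_s (standard basis vector of V = 'i => real).\<close>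
definition simple_root :: "'i \<Rightarrow> ('i \<Rightarrow> real)" where
  "simple_root s = (\<lambda>j. if j = s then 1 else 0)"

text \<open>Simple reflection sigma_s(v) = v - 2 B(e_s, v) e_s.\<close>
definition cox_refl :: "('i::finite \<Rightarrow> 'i \<Rightarrow> nat) \<Rightarrow> 'i \<Rightarrow> ('i \<Rightarrow> real) \<Rightarrow> ('i \<Rightarrow> real)" where
  "cox_refl m s v = (\<lambda>k. v k - 2 * (\<Sum>j\<in>UNIV. cox_B m s j * v j) * simple_root s k)"

text \<open>The group W generated by the simple reflections (acting on V).\<close>
inductive_set cox_group :: "('i::finite \<Rightarrow> 'i \<Rightarrow> nat) \<Rightarrow> (('i \<Rightarrow> real) \<Rightarrow> ('i \<Rightarrow> real)) set"
  for m where
  id: "id \<in> cox_group m"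
| step: "w \<in> cox_group m \<Longrightarrow> cox_refl m s \<circ> w \<in> cox_group m"

text \<open>Negative roots: roots w(e_s) with all coordinates nonpositive.\<close>
definition neg_roots :: "('i::finite \<Rightarrow> 'i \<Rightarrow> nat) \<Rightarrow> ('i \<Rightarrow> real) set" where
  "neg_roots m = {v. (\<exists>w\<in>cox_group m. \<exists>s. v = w (simple_root s)) \<and> (\<forall>k. v k \<le> 0)}"

definition des :: "('i::finite \<Rightarrow> 'i \<Rightarrow> nat) \<Rightarrow> (('i \<Rightarrow> real) \<Rightarrow> ('i \<Rightarrow> real)) \<Rightarrow> nat" where
  "des m w = card {s. w (simple_root s) \<in> neg_roots m}"

text \<open>Irreducible: the Coxeter graph (edge i--j iff m_ij <> 2, i <> j) is connected.\<close>
definition cox_irreducible :: "('i \<Rightarrow> 'i \<Rightarrow> nat) \<Rightarrow> bool" where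
  "cox_irreducible m \<longleftrightarrow> (\<forall>i j. (i, j) \<in> {(a, b). a \<noteq> b \<and> m a b \<noteq> 2}\<^sup>*)"

text \<open>Order of an element of W.\<close>
definition elem_order :: "('a \<Rightarrow> 'a) \<Rightarrow> nat" where
  "elem_order c = (LEAST k. k > 0 \<and> c ^^ k = id)"

text \<open>Coxeter element for an enumeration ss of S: product of the simple reflections in that order.\<close>
definition cox_element :: "('i::finite \<Rightarrow> 'i \<Rightarrow> nat) \<Rightarrow> 'i list \<Rightarrow> (('i \<Rightarrow> real) \<Rightarrow> ('i \<Rightarrow> real))" where
  "cox_element m ss = foldr (\<lambda>s c. cox_refl m s \<circ> c) ss id"

text \<open>Uniform expectation and variance over a finite set.\<close>
definition unif_mean :: "'a set \<Rightarrow> ('a \<Rightarrow> real) \<Rightarrow> real" where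
  "unif_mean A X = (\<Sum>a\<in>A. X a) / real (card A)"

definition unif_var :: "'a set \<Rightarrow> ('a \<Rightarrow> real) \<Rightarrow> real" where
  "unif_var A X = (\<Sum>a\<in>A. (X a - unif_mean A X)\<^sup>2) / real (card A)"

end

theory Submission
  imports Defs "HOL-Analysis.Analysis"
begin

text \<open>Write \<open>des w\<close> through the signs of the roots \<open>w (e s)\<close>. Right multiplication by \<open>r s\<close>
  changes the sign of \<open>w (e s)\<close>, and it keeps that of \<open>inv w (e t)\<close> unless \<open>w (e s) = \<plusminus> e t\<close>. Hence
  the expectation is \<open>n\<close>, and the covariance of \<open>des w\<close> and \<open>des (inv w)\<close> is one quarter of the sum
  over \<open>s, t\<close> of the proportion of \<open>w\<close> with \<open>w (e s) = \<plusminus> e t\<close>. This equals \<open>n / (2 h)\<close> because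
  every orbit \<open>R\<close> of roots has \<open>h\<close> times as many elements as it has simple roots.

  For the last fact, the Coxeter graph is a forest, so one may take a bipartite Coxeter element \<open>c\<close>.
  Projected to the Coxeter plane (spanned with the help of a Perron vector of the Coxeter graph),
  \<open>c\<close> is a rotation by \<open>2 \<pi> / h\<close> and the positive roots lie in a half plane; so for each root \<open>b\<close>
  exactly one \<open>k < h\<close> satisfies \<open>c ^^ k b > 0\<close> and \<open>c ^^ Suc k b < 0\<close>. On the other hand \<open>c\<close> makes as
  many positive roots of \<open>R\<close> negative as there are simple roots in \<open>R\<close>. Count the pairs
  \<open>(b, k)\<close> in both ways.\<close>

lemma simple_root_apply: "simple_root s k = (if k = s then 1 else 0)"
  by (simp add: simple_root_def)

lemma sum_simple_root [simp]:
  fixes f :: "'i::finite \<Rightarrow> real"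
  shows "(\<Sum>k\<in>UNIV. f k * simple_root s k) = f s" "(\<Sum>k\<in>UNIV. simple_root s k * f k) = f s"
    "(\<Sum>k\<in>UNIV. f k * simple_root k s) = f s"
  by (simp_all add: simple_root_apply if_distrib if_distribR cong: if_cong)

section \<open>The geometric representation\<close>

locale coxeter =
  fixes m :: "'i::finite \<Rightarrow> 'i \<Rightarrow> nat"
  assumes cm: "coxeter_matrix m"
begin

abbreviation "W \<equiv> cox_group m"
abbreviation "r \<equiv> cox_refl m"
abbreviation "e \<equiv> (simple_root :: 'i \<Rightarrow> _)"
abbreviation "B \<equiv> cox_B m"
abbreviation "word \<equiv> cox_element m"

definition pair :: "'i \<Rightarrow> ('i \<Rightarrow> real) \<Rightarrow> real" where
  "pair s v = (\<Sum>j\<in>UNIV. B s j * v j)"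

definition form :: "('i \<Rightarrow> real) \<Rightarrow> ('i \<Rightarrow> real) \<Rightarrow> real" where
  "form u v = (\<Sum>s\<in>UNIV. u s * pair s v)"

lemma B_diag [simp]: "B s s = 1"
  using cm by (simp add: coxeter_matrix_def cox_B_def)

lemma B_sym: "B s t = B t s"
  using cm by (simp add: coxeter_matrix_def cox_B_def)

lemma pair_e [simp]: "pair s (e t) = B s t"
  by (simp add: pair_def)

lemma pair_lin: "pair s (\<lambda>k. a * u k + b * v k) = a * pair s u + b * pair s v"
  by (simp add: pair_def algebra_simps sum.distrib sum_distrib_left)

lemma pair_scale: "pair s (\<lambda>k. a * u k) = a * pair s u"
  using pair_lin[of s a u 0 u] by simp

lemma form_sym: "form u v = form v u"
proof -
  have "form u v = (\<Sum>s\<in>UNIV. \<Sum>j\<in>UNIV. B s j * u s * v j)"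
    by (simp add: form_def pair_def sum_distrib_left algebra_simps)
  also have "\<dots> = (\<Sum>j\<in>UNIV. \<Sum>s\<in>UNIV. B s j * u s * v j)" by (rule sum.swap)
  also have "\<dots> = form v u"
    by (simp add: form_def pair_def sum_distrib_left algebra_simps) (simp add: B_sym)
  finally show ?thesis .
qed

lemma form_lin: "form (\<lambda>k. a * u k + b * u' k) v = a * form u v + b * form u' v"
  by (simp add: form_def algebra_simps sum.distrib sum_distrib_left)

lemma form_e [simp]: "form (e s) v = pair s v"
  by (simp add: form_def)

text \<open>The factor \<open>1 *\<close> puts the reflection in the shape that
  \<open>pair_lin\<close>, \<open>form_lin\<close> and \<open>ip_lin\<close> rewrite.\<close>

lemma refl_eq: "r s v = (\<lambda>k. 1 * v k + (- 2 * pair s v) * e s k)"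
  by (auto simp: cox_refl_def pair_def)

lemma refl_other: "k \<noteq> s \<Longrightarrow> r s v k = v k"
  by (simp add: cox_refl_def simple_root_apply)

lemma refl_self: "r s v s = v s - 2 * pair s v"
  by (simp add: refl_eq simple_root_apply)

lemma pair_refl: "pair t (r s v) = pair t v - 2 * pair s v * B t s"
  unfolding refl_eq pair_lin by simp

lemma refl_refl [simp]: "r s (r s v) = v"
  unfolding refl_eq[of s "r s v"] pair_refl by (simp add: refl_eq)

lemma refl_comp_refl [simp]: "r s \<circ> r s = id"
  by (simp add: fun_eq_iff)

lemma refl_fixes: "pair s v = 0 \<Longrightarrow> r s v = v"
  by (simp add: refl_eq)

lemma refl_simple [simp]: "r s (e s) = (\<lambda>k. - e s k)"
  by (auto simp: refl_eq)

lemma form_refl: "form (r s u) (r s v) = form u v"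
proof -
  have 1: "form (r s u) w = form u w - 2 * pair s u * pair s w" for u w
    unfolding refl_eq form_lin by simp
  have "form (r s u) (r s v) = form u (r s v) - 2 * pair s u * pair s (r s v)" by (rule 1)
  also have "form u (r s v) = form u v - 2 * pair s v * pair s u"
    unfolding form_sym[of u] 1 by (simp add: form_sym)
  finally show ?thesis by (simp add: pair_refl algebra_simps)
qed

lemma word_Nil [simp]: "word [] = id"
  and word_Cons [simp]: "word (s # xs) = r s \<circ> word xs"
  by (simp_all add: cox_element_def)

lemma word_append [simp]: "word (xs @ ys) = word xs \<circ> word ys"
  by (induction xs) (auto simp: comp_assoc)

lemma word_in [simp]: "word xs \<in> W"
  by (induction xs) (auto simp only: word_Nil word_Cons intro: cox_group.intros)

lemma group_word: "w \<in> W \<Longrightarrow> \<exists>xs. w = word xs"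
proof (induction rule: cox_group.induct)
  case id
  then show ?case by (intro exI[of _ "[]"]) simp
next
  case (step w s)
  then obtain xs where "w = word xs" by blast
  then show ?case by (intro exI[of _ "s # xs"]) simp
qed

lemma refl_in [simp]: "r s \<in> W"
  using word_in[of "[s]"] by simp

lemma comp_in [simp]: "v \<in> W \<Longrightarrow> w \<in> W \<Longrightarrow> v \<circ> w \<in> W"
  using group_word[of v] group_word[of w] by (metis word_append word_in)

lemma funpow_in [simp]: "w \<in> W \<Longrightarrow> w ^^ k \<in> W"
  by (induction k) (auto intro: cox_group.id)

lemma word_rev: "word (rev xs) \<circ> word xs = id"
proof (induction xs)
  case (Cons s xs)
  have "word (rev (s # xs)) \<circ> word (s # xs) = word (rev xs) \<circ> (r s \<circ> r s) \<circ> word xs"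
    by (simp add: comp_assoc del: refl_comp_refl)
  then show ?case using Cons by simp
qed simp

lemma inv_word: "inv (word xs) = word (rev xs)"
  by (metis inv_unique_comp word_rev rev_rev_ident)

lemma inv_in [simp]: "w \<in> W \<Longrightarrow> inv w \<in> W"
  using group_word[of w] inv_word by auto

lemma bij_in: "w \<in> W \<Longrightarrow> bij w"
  by (metis group_word word_rev rev_rev_ident o_bij)

lemma inv_apply [simp]: "w \<in> W \<Longrightarrow> inv w (w v) = v" "w \<in> W \<Longrightarrow> w (inv w v) = v"
  using bij_in by (auto simp: bij_is_inj bij_is_surj surj_f_inv_f)

lemma inv_comp_refl: "w \<in> W \<Longrightarrow> inv (w \<circ> r s) = r s \<circ> inv w"
  by (rule inv_unique_comp) (auto simp: fun_eq_iff)

lemma expand: "w \<in> W \<Longrightarrow> w u k = (\<Sum>s\<in>UNIV. u s * w (e s) k)"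
proof (induction arbitrary: k rule: cox_group.induct)
  case (step w t)
  have "pair t (w u) = (\<Sum>s\<in>UNIV. u s * pair t (w (e s)))"
    unfolding pair_def step.IH[of ] sum_distrib_left
    by (subst sum.swap) (simp add: algebra_simps)
  then show ?case
    by (simp add: refl_eq step.IH right_diff_distrib sum_subtractf sum_distrib_left
        sum_distrib_right sum_negf mult_ac)
qed simp

lemma lin: "w \<in> W \<Longrightarrow> w (\<lambda>k. a * u k + b * v k) = (\<lambda>k. a * w u k + b * w v k)"
proof
  fix k assume w: "w \<in> W"
  show "w (\<lambda>k. a * u k + b * v k) k = a * w u k + b * w v k"
    using expand[OF w, of "\<lambda>k. a * u k + b * v k" k] expand[OF w, of u k] expand[OF w, of v k]
    by (simp add: algebra_simps sum.distrib sum_distrib_left)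
qed

lemma lin_scale: "w \<in> W \<Longrightarrow> w (\<lambda>k. a * u k) = (\<lambda>k. a * w u k)"
  using lin[of w a u 0 u] by simp

lemma lin_minus: "w \<in> W \<Longrightarrow> w (\<lambda>k. - u k) = (\<lambda>k. - w u k)"
  using lin_scale[of w "-1" u] by simp

lemma form_inv: "w \<in> W \<Longrightarrow> form (w u) (w v) = form u v"
  by (induction rule: cox_group.induct) (auto simp: form_refl)

lemma bij_betw_comp_refl: "bij_betw (\<lambda>w. w \<circ> r s) W W"
  by (rule bij_betw_byWitness[where f' = "\<lambda>w. w \<circ> r s"]) (auto simp: comp_assoc)

lemma bij_betw_inv: "bij_betw inv W W"
  by (rule bij_betw_byWitness[where f' = inv]) (auto simp: bij_in inv_inv_eq)

definition adj :: "'i \<Rightarrow> 'i \<Rightarrow> bool" where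
  "adj i j \<longleftrightarrow> i \<noteq> j \<and> m i j \<noteq> 2"

lemma adj_sym: "adj i j \<Longrightarrow> adj j i"
  using cm by (auto simp: adj_def coxeter_matrix_def)

lemma B_nonadj: "i \<noteq> j \<Longrightarrow> \<not> adj i j \<Longrightarrow> B i j = 0"
  by (simp add: adj_def cox_B_def)

text \<open>An edge has label at least 3 or infinity, and cos(pi/3) = 1/2. This value is what
  excludes cycles in \<open>leaf_exists\<close>.\<close>

lemma B_adj: "adj i j \<Longrightarrow> B i j \<le> - 1/2"
proof (cases "m i j = 0")
  case False
  assume a: "adj i j"
  then have "m i j \<ge> 3" using False cm
    unfolding adj_def coxeter_matrix_def
    by (metis Suc_1 Suc_leI eval_nat_numeral(3) less_2_cases linorder_neqE_nat One_nat_def)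
  then have "cos (pi / 3) \<le> cos (pi / real (m i j))"
    by (intro cos_monotone_0_pi_le) (auto simp: field_simps)
  then show ?thesis using False by (simp add: cox_B_def cos_60)
qed (simp add: cox_B_def)

lemma B_nonpos: "i \<noteq> j \<Longrightarrow> B i j \<le> 0"
  using B_nonadj B_adj by fastforce

lemma refl_commute: "i \<noteq> j \<Longrightarrow> \<not> adj i j \<Longrightarrow> r i \<circ> r j = r j \<circ> r i"
proof -
  assume "i \<noteq> j" "\<not> adj i j"
  then have "B i j = 0" "B j i = 0" using B_nonadj B_sym by metis+
  then show ?thesis by (auto simp: fun_eq_iff refl_eq[of i "r j _"] refl_eq[of j "r i _"] pair_refl)
      (simp add: refl_eq)
qed

end

section \<open>Positive definiteness of the Tits form for finite \<open>W\<close>\<close>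

locale finite_coxeter = coxeter m for m :: "'i::finite \<Rightarrow> 'i \<Rightarrow> nat" +
  assumes irr: "cox_irreducible m" and fin: "finite (cox_group m)"
begin

lemma connected_induct:
  assumes "P i" and "\<And>i j. adj i j \<Longrightarrow> P i \<Longrightarrow> P j"
  shows "P j"
proof -
  have "(i, j) \<in> {(a, b). a \<noteq> b \<and> m a b \<noteq> 2}\<^sup>*"
    using irr by (simp add: cox_irreducible_def)
  then show ?thesis
    by (induction rule: rtrancl_induct) (use assms in \<open>auto simp: adj_def\<close>)
qed

text \<open>Weyl averaging: the standard inner product summed over the finite group, left
  unnormalised because only invariance and positivity matter.\<close>

definition ip :: "('i \<Rightarrow> real) \<Rightarrow> ('i \<Rightarrow> real) \<Rightarrow> real" where
  "ip u v = (\<Sum>w\<in>W. \<Sum>k\<in>UNIV. w u k * w v k)"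

lemma ip_sym: "ip u v = ip v u"
  by (simp add: ip_def mult.commute)

lemma ip_lin: "ip (\<lambda>k. a * u k + b * u' k) v = a * ip u v + b * ip u' v"
  unfolding ip_def sum_distrib_left sum.distrib[symmetric]
  by (intro sum.cong refl, subst lin, assumption) (simp add: algebra_simps)

lemma ip_refl: "ip (r s u) (r s v) = ip u v"
  unfolding ip_def
  using sum.reindex_bij_betw[OF bij_betw_comp_refl, of "\<lambda>w. \<Sum>k\<in>UNIV. w u k * w v k" s]
  by simp

lemma ip_pos: "u \<noteq> (\<lambda>_. 0) \<Longrightarrow> ip u u > 0"
proof -
  assume "u \<noteq> (\<lambda>_. 0)"
  then obtain k where k: "u k \<noteq> 0" by auto
  have "0 < (\<Sum>k\<in>UNIV. u k * u k)"
    by (rule sum_pos2[of _ k]) (use k in \<open>auto simp: zero_less_mult_iff\<close>)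
  also have "\<dots> \<le> ip u u"
    unfolding ip_def
    using sum_mono2[OF fin, of "{id}" "\<lambda>w. \<Sum>k\<in>UNIV. w u k * w u k"] cox_group.id[of m]
    by (simp add: sum_nonneg)
  finally show ?thesis .
qed

text \<open>Invariance of \<open>ip\<close> under the reflection in \<open>e s\<close> forces that reflection to be the
  \<open>ip\<close>-orthogonal one.\<close>
lemma ip_simple: "ip (e s) v = pair s v * ip (e s) (e s)"
proof -
  have "ip (e s) v = ip (\<lambda>k. -1 * e s k + 0 * e s k) (r s v)"
    using ip_refl[of s "e s" v] by simp
  also have "\<dots> = - ip (r s v) (e s)" unfolding ip_lin by (simp add: ip_sym[of "e s" "r s v"])
  also have "ip (r s v) (e s) = ip v (e s) - 2 * pair s v * ip (e s) (e s)"
    unfolding refl_eq ip_lin by simp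
  finally show ?thesis by (simp add: ip_sym[of v])
qed

lemma e_nonzero: "e s \<noteq> (\<lambda>_. 0)"
  by (auto simp: simple_root_def fun_eq_iff)

text \<open>By \<open>ip_simple\<close> at either end, \<open>ip (e i) (e j)\<close> is
  \<open>B i j\<close> times either norm. As \<open>B i j\<close> is nonzero on an edge, the norms
  agree there, and connectedness does the rest.\<close>

lemma ip_const: "ip (e s) (e s) = ip (e t) (e t)"
proof (rule connected_induct[of "\<lambda>t. ip (e s) (e s) = ip (e t) (e t)" s])
  fix i j assume a: "adj i j" and "ip (e s) (e s) = ip (e i) (e i)"
  moreover have "B i j * ip (e i) (e i) = B i j * ip (e j) (e j)"
    using ip_simple[of i "e j"] ip_simple[of j "e i"] by (simp add: ip_sym B_sym)
  ultimately show "ip (e s) (e s) = ip (e j) (e j)" using B_adj[OF a] by simp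
qed simp

text \<open>By \<open>ip_simple\<close> and \<open>ip_const\<close> the averaged product is a
  positive multiple of \<open>form\<close>.\<close>

lemma form_pos: assumes "u \<noteq> (\<lambda>_. 0)" shows "form u u > 0"
proof -
  obtain s :: 'i where True by simp
  have "ip u u = (\<Sum>w\<in>W. \<Sum>k\<in>UNIV. \<Sum>t\<in>UNIV. u t * w (e t) k * w u k)"
    unfolding ip_def
    by (intro sum.cong refl, subst expand, assumption) (simp add: sum_distrib_right)
  also have "\<dots> = (\<Sum>t\<in>UNIV. u t * ip (e t) u)"
    unfolding ip_def sum_distrib_left
    by (subst sum.swap[of _ UNIV UNIV], subst sum.swap[of _ UNIV W]) (simp add: mult.assoc)
  also have "\<dots> = form u u * ip (e s) (e s)"
  proof -
    have "ip (e t) u = pair t u * ip (e s) (e s)" for t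
      using ip_simple[of t u] ip_const[of t s] by simp
    then show ?thesis by (simp add: form_def sum_distrib_right mult.assoc)
  qed
  finally show ?thesis using ip_pos[OF assms] ip_pos[OF e_nonzero, of s]
    by (metis zero_less_mult_pos2)
qed

end

section \<open>Length and the sign of roots\<close>

context coxeter
begin

definition len :: "(('i \<Rightarrow> real) \<Rightarrow> ('i \<Rightarrow> real)) \<Rightarrow> nat" where
  "len w = (LEAST n. \<exists>xs. length xs = n \<and> word xs = w)"

lemma len_word: "len (word xs) \<le> length xs"
  unfolding len_def by (rule Least_le) blast

lemma reduced_word: assumes "w \<in> W" shows "\<exists>xs. length xs = len w \<and> word xs = w"
proof -
  obtain xs where "w = word xs" using group_word[OF assms] by blast
  then have "\<exists>ys. length ys = length xs \<and> word ys = w" by blast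
  then show ?thesis unfolding len_def by (rule LeastI)
qed

lemma len_comp: assumes "v \<in> W" shows "len (v \<circ> word xs) \<le> len v + length xs"
proof -
  obtain ys where "length ys = len v" "word ys = v" using reduced_word[OF assms] by blast
  then show ?thesis using len_word[of "ys @ xs"] by simp
qed

lemma len_refl: "w \<in> W \<Longrightarrow> len (w \<circ> r s) \<le> Suc (len w)"
  using len_comp[of w "[s]"] by simp

lemma len_refl': "w \<in> W \<Longrightarrow> len w \<le> Suc (len (w \<circ> r s))"
  using len_refl[of "w \<circ> r s" s] by (simp add: comp_assoc)

lemma descent_exists:
  assumes "w \<in> W" "w \<noteq> id"
  shows "\<exists>t. len w = Suc (len (w \<circ> r t))"
proof -
  obtain xs where xs: "length xs = len w" "word xs = w" using reduced_word[OF assms(1)] by blast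
  then have "xs \<noteq> []" using assms(2) by auto
  then obtain ys t where ys: "xs = ys @ [t]" by (metis rev_exhaust)
  then have "word ys = w \<circ> r t" using xs(2) by (auto simp: comp_assoc)
  then have "len (w \<circ> r t) \<le> length ys" using len_word[of ys] by simp
  then show ?thesis using len_refl'[OF assms(1), of t] xs(1) ys by (intro exI[of _ t]) simp
qed

text \<open>The word grows on the left; its last letter is always \<open>t\<close>.\<close>
fun alt :: "'i \<Rightarrow> 'i \<Rightarrow> nat \<Rightarrow> 'i list" where
  "alt s t 0 = []"
| "alt s t (Suc k) = (if even k then t else s) # alt s t k"

lemma length_alt [simp]: "length (alt s t k) = k"
  by (induction k) auto

lemma alt_last: "\<exists>zs. alt s t (Suc k) = zs @ [t]"
  by (induction k) auto

lemma alt_add: "\<exists>zs. alt s t (j + k) = zs @ alt s t k \<and> length zs = j"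
  by (induction j) (auto intro: exI[of _ "_ # _"])

section \<open>Dihedral subgroups and the braid relation\<close>

lemma refl_comb:
  "r s (\<lambda>k. x * e s k + y * e t k) = (\<lambda>k. (- x - 2 * B s t * y) * e s k + y * e t k)"
  "r t (\<lambda>k. x * e s k + y * e t k) = (\<lambda>k. x * e s k + (- y - 2 * B s t * x) * e t k)"
  unfolding refl_eq pair_lin by (auto simp: algebra_simps B_sym[of t s])

lemma sin_step:
  fixes g :: real
  shows "sin ((x + 1) * g) = 2 * cos g * sin (x * g) - sin ((x - 1) * g)"
  by (simp add: algebra_simps sin_add sin_diff)

text \<open>The coefficients obey the Chebyshev recurrence of \<open>sin_step\<close>. The second
  word applies \<open>r s\<close> first and so begins by negating \<open>e s\<close>; hence its sign
  and its shifted indices.\<close>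

lemma alt_action:
  assumes "B s t = - cos g" "sin g \<noteq> 0"
  defines "U \<equiv> \<lambda>x. sin (x * g) / sin g"
  shows "word (alt s t k) (e s) = (if even k
      then (\<lambda>j. U (real k + 1) * e s j + U (real k) * e t j)
      else (\<lambda>j. U (real k) * e s j + U (real k + 1) * e t j))" (is ?A)
    and "word (alt t s k) (e s) = (if even k
      then (\<lambda>j. - U (real k - 1) * e s j + - U (real k) * e t j)
      else (\<lambda>j. - U (real k) * e s j + - U (real k - 1) * e t j))" (is ?B)
proof -
  have step: "U (x + 1) = 2 * cos g * U x - U (x - 1)" for x
    unfolding U_def sin_step[of x] by (simp add: diff_divide_distrib)
  have U1: "U 0 = 0" "U 1 = 1" "U (-1) = -1" using assms by (simp_all add: U_def)
  show ?A
  proof (induction k)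
    case (Suc k)
    have "U (real (Suc k) + 1) = 2 * cos g * U (real k + 1) - U (real k)"
      using step[of "real k + 1"] by (simp add: add.commute)
    then show ?case unfolding alt.simps word_Cons o_apply Suc
      by (auto simp: refl_comb assms(1)) (auto simp: algebra_simps)
  qed (simp add: U1)
  show ?B
  proof (induction k)
    case (Suc k)
    have "U (real (Suc k)) = 2 * cos g * U (real k) - U (real k - 1)"
      using step[of "real k"] by (simp add: add.commute)
    then show ?case unfolding alt.simps word_Cons o_apply Suc
      by (cases "even k"; simp only: even_Suc simp_thms if_True if_False refl_comb)
        (simp_all add: assms(1) algebra_simps)
  qed (simp add: U1)
qed

lemma word_fixes: "(\<And>s. s \<in> set xs \<Longrightarrow> pair s v = 0) \<Longrightarrow> word xs v = v"
  by (induction xs) (auto simp: refl_fixes)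

lemma set_alt: "set (alt s t k) \<subseteq> {s, t}"
  by (induction k) auto

text \<open>By \<open>alt_action\<close> with angle pi/m the two words agree on \<open>e s\<close>
  and \<open>e t\<close>. Both fix every vector orthogonal to these two, and such vectors together
  with the plane span the space.\<close>

lemma braid_relation:
  assumes "s \<noteq> t" "m s t \<noteq> 0"
  shows "word (alt s t (m s t)) = word (alt t s (m s t))"
proof -
  let ?k = "m s t" and ?g = "pi / real (m s t)"
  have k2: "?k \<ge> 2" using assms cm unfolding coxeter_matrix_def
    by (metis One_nat_def less_2_cases not_le)
  have B: "B s t = - cos ?g" "B t s = - cos ?g" using assms(2) B_sym[of t s] by (simp_all add: cox_B_def)
  have g: "0 < ?g" "?g < pi" using k2 by (auto simp: field_simps)
  have sg: "sin ?g > 0" using g by (intro sin_gt_zero)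
  have ks: "real ?k * ?g = pi" using assms(2) by simp
  have sk: "sin ((real ?k + 1) * ?g) = - sin ?g" "sin ((real ?k - 1) * ?g) = sin ?g" "sin (real ?k * ?g) = 0"
    unfolding distrib_right left_diff_distrib ks by simp_all
  have es: "word (alt s t ?k) (e s) = word (alt t s ?k) (e s)"
    if "B s t = - cos ?g" for s t
    unfolding alt_action[OF that less_imp_neq[OF sg, symmetric]] sk using sg by auto
  have es1: "word (alt s t ?k) (e s) = word (alt t s ?k) (e s)"
    and es2: "word (alt s t ?k) (e t) = word (alt t s ?k) (e t)"
    using es[of s t] es[of t s] B by simp_all
  show ?thesis
  proof
    fix v
    \<comment> \<open>\<open>?d\<close> is the Gram determinant of \<open>e s\<close> and
      \<open>e t\<close>, nonzero as the square of a sine. \<open>?x\<close> and \<open>?y\<close>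
      solve the Gram system, so \<open>v0\<close> is the part of \<open>v\<close> orthogonal to
      both.\<close>
    let ?d = "1 - (B s t)\<^sup>2"
    let ?x = "(pair s v - B s t * pair t v) / ?d" and ?y = "(pair t v - B s t * pair s v) / ?d"
    have d: "?d \<noteq> 0" using sg B sin_cos_squared_add[of ?g] by (auto simp: power2_eq_square)
    define v0 where "v0 = (\<lambda>k. 1 * v k + (-1) * (?x * e s k + ?y * e t k))"
    have xy: "?x + ?y * B s t = pair s v" "?x * B s t + ?y = pair t v"
      using d by (simp_all add: divide_simps) (simp_all add: algebra_simps power2_eq_square)
    have v0: "pair s v0 = 0" "pair t v0 = 0"
      using xy unfolding v0_def pair_lin by (simp_all add: B_sym[of t s])
    have v: "v = (\<lambda>k. 1 * v0 k + 1 * (?x * e s k + ?y * e t k))" by (auto simp: v0_def)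
    have fx: "word (alt s t k) v0 = v0" "word (alt t s k) v0 = v0" for k
      by (rule word_fixes; use set_alt[of s t k] set_alt[of t s k] v0 in blast)+
    show "word (alt s t ?k) v = word (alt t s ?k) v"
      by (subst (1 2) v) (simp only: lin[OF word_in] fx es1 es2)
  qed
qed

end

section \<open>Every root is positive or negative\<close>

context finite_coxeter
begin

text \<open>For an infinite label, \<open>e s + e t\<close> would be a nonzero vector of norm
  zero.\<close>

lemma m_nonzero: "m s t \<noteq> 0"
proof
  assume 0: "m s t = 0"
  then have "s \<noteq> t" using cm by (auto simp: coxeter_matrix_def)
  then have "(\<lambda>k. 1 * e s k + 1 * e t k) \<noteq> (\<lambda>_. 0)"
    by (auto simp: simple_root_def fun_eq_iff intro!: exI[of _ s])
  then have "form (\<lambda>k. 1 * e s k + 1 * e t k) (\<lambda>k. 1 * e s k + 1 * e t k) > 0" by (rule form_pos)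
  then show False unfolding form_lin form_e pair_lin using 0 B_sym[of t s] by (simp add: cox_B_def[of m s t])
qed

text \<open>Write \<open>w = v u\<close> with \<open>u\<close> the longest alternating word in \<open>s\<close> and a descent \<open>t\<close> such that
  lengths add. Then \<open>v\<close> lengthens under both \<open>s\<close> and \<open>t\<close>, and \<open>u (e s)\<close> is a nonnegative combination
  of \<open>e s\<close> and \<open>e t\<close>, its coefficients being values of the sine on \<open>[0, \<pi>]\<close>.\<close>
lemma ascent_nonneg:
  assumes "w \<in> W" "len w \<le> len (w \<circ> r s)"
  shows "0 \<le> w (e s) k"
  using assms
proof (induction "len w" arbitrary: w s k rule: less_induct)
  case less
  show ?case
  proof (cases "w = id")
    case True
    then show ?thesis by (simp add: simple_root_apply)
  next
    case False
    then obtain t where t: "len w = Suc (len (w \<circ> r t))" using descent_exists less.prems by blast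
    then have st: "s \<noteq> t" using less.prems by auto
    \<comment> \<open>An alternating suffix of length \<open>q\<close> splits off with lengths
      adding; since \<open>q\<close> is bounded by the length of \<open>w\<close>, a maximal one
      exists.\<close>
    define P where "P q \<longleftrightarrow> (\<exists>v\<in>W. w = v \<circ> word (alt s t q) \<and> len w = len v + q)" for q
    have "P 1" unfolding P_def using t less.prems
      by (intro bexI[of _ "w \<circ> r t"]) (auto simp: comp_assoc)
    moreover have "P q \<Longrightarrow> q \<le> len w" for q unfolding P_def by auto
    ultimately obtain q where q: "P q" "\<And>q'. P q' \<Longrightarrow> q' \<le> q"
      using ex_has_greatest_nat[of P 1 id "Suc (len w)"] by (auto simp: less_Suc_eq_le)
    from q(2)[OF \<open>P 1\<close>] obtain q' where q': "q = Suc q'" by (cases q) auto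
    obtain v where v: "v \<in> W" "w = v \<circ> word (alt s t q)" "len w = len v + q"
      using q(1) unfolding P_def by blast
    \<comment> \<open>This letter would continue the alternating word, so a descent contradicts the
      maximality of \<open>q\<close>.\<close>
    have asc1: "len v \<le> len (v \<circ> r (if even q then t else s))"
    proof (rule ccontr)
      let ?x = "if even q then t else s"
      assume "\<not> ?thesis"
      then have "len v = Suc (len (v \<circ> r ?x))" using len_refl'[OF v(1), of ?x] by simp
      then have "P (Suc q)" unfolding P_def using v
        by (intro bexI[of _ "v \<circ> r ?x"]) (auto simp: fun_eq_iff)
      then show False using q(2) by fastforce
    qed
    \<comment> \<open>This is the leftmost letter of \<open>alt s t q\<close>. If it were a descent
      of \<open>v\<close>, cancelling it would give too short a word for \<open>w\<close>.\<close>
    have asc2: "len v \<le> len (v \<circ> r (if even q then s else t))"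
    proof (rule ccontr)
      let ?x = "if even q then s else t"
      assume "\<not> ?thesis"
      then have l: "len v = Suc (len (v \<circ> r ?x))" using len_refl'[OF v(1), of ?x] by simp
      have "w = (v \<circ> r ?x) \<circ> word (alt s t q')" using v(2) q' by (auto simp: fun_eq_iff)
      then have "len w \<le> len (v \<circ> r ?x) + q'" using len_comp[of "v \<circ> r ?x" "alt s t q'"] v(1) by simp
      then show False using l v(3) q' by simp
    qed
    have asc: "len v \<le> len (v \<circ> r s)" "len v \<le> len (v \<circ> r t)"
      using asc1 asc2 by (auto split: if_splits)
    have lv: "len v < len w" using v(3) q' by simp
    have pos: "0 \<le> v (e s) k" "0 \<le> v (e t) k" using less.hyps[OF lv v(1)] asc by auto
    \<comment> \<open>Otherwise the braid relation makes the suffix end in \<open>s\<close>, and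
      \<open>w \<circ> r s\<close> becomes shorter than \<open>w\<close>. The strict bound keeps the
      sine arguments, with indices up to \<open>q + 1\<close>, in [0, pi].\<close>
    have qm: "q < m s t"
    proof (rule ccontr)
      assume "\<not> ?thesis"
      then obtain j where j: "q = j + m s t" by (metis add.commute le_Suc_ex not_less)
      obtain zs where zs: "alt s t q = zs @ alt s t (m s t)" "length zs = j"
        using alt_add[of s t j "m s t"] j by auto
      obtain n where n: "m s t = Suc n" using m_nonzero[of s t] by (cases "m s t") auto
      obtain ys where ys: "alt t s (m s t) = ys @ [s]" using alt_last[of t s n] n by auto
      have "length (alt t s (m s t)) = Suc (length ys)" unfolding ys by simp
      then have ly: "Suc (length ys) = m s t" by simp
      have "w = v \<circ> word zs \<circ> word (alt t s (m s t))"
        using v(2) braid_relation[OF st m_nonzero] zs(1) by (simp add: comp_assoc)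
      then have "w \<circ> r s = v \<circ> word (zs @ ys)"
        unfolding ys by (auto simp: fun_eq_iff)
      then have "len (w \<circ> r s) \<le> len v + (length zs + length ys)"
        using len_comp[OF v(1), of "zs @ ys"] by simp
      then show False using less.prems(2) v(3) j zs(2) ly by simp
    qed
    let ?g = "pi / real (m s t)"
    have m1: "m s t \<noteq> 1" using cm st by (auto simp: coxeter_matrix_def)
    have g: "0 < ?g" "?g < pi" using m1 m_nonzero[of s t] by (auto simp: field_simps)
    then have sg: "sin ?g > 0" by (intro sin_gt_zero)
    have U: "0 \<le> sin (x * ?g) / sin ?g" if "0 \<le> x" "x \<le> real (m s t)" for x
      using that sg g m_nonzero[of s t] by (intro divide_nonneg_pos sin_ge_zero) (auto simp: field_simps)
    have B: "B s t = - cos ?g" using m_nonzero[of s t] by (simp add: cox_B_def)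
    have comb: "\<exists>x y. 0 \<le> x \<and> 0 \<le> y \<and> (\<lambda>j. X * e s j + Y * e t j) = (\<lambda>j. x * e s j + y * e t j)"
      if "0 \<le> X" "0 \<le> Y" for X Y :: real using that by blast
    have "\<exists>x y. 0 \<le> x \<and> 0 \<le> y \<and> word (alt s t q) (e s) = (\<lambda>j. x * e s j + y * e t j)"
      unfolding alt_action(1)[OF B less_imp_neq[OF sg, symmetric]]
      by (cases "even q"; simp only: simp_thms if_True if_False; rule comb; rule U) (use qm in auto)
    then obtain x y where xy: "0 \<le> x" "0 \<le> y" "word (alt s t q) (e s) = (\<lambda>j. x * e s j + y * e t j)"
      by blast
    have "w (e s) = (\<lambda>j. x * v (e s) j + y * v (e t) j)"
      unfolding v(2) o_apply xy(3) using lin[OF v(1)] by simp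
    then show ?thesis using xy pos by simp
  qed
qed

definition pos :: "('i \<Rightarrow> real) \<Rightarrow> bool" where "pos v \<longleftrightarrow> (\<forall>k. 0 \<le> v k)"
definition neg :: "('i \<Rightarrow> real) \<Rightarrow> bool" where "neg v \<longleftrightarrow> (\<forall>k. v k \<le> 0)"
definition roots :: "('i \<Rightarrow> real) set" where "roots = {w (e s) | w s. w \<in> W}"

lemma neg_minus [simp]: "neg (\<lambda>k. - v k) \<longleftrightarrow> pos v" "pos (\<lambda>k. - v k) \<longleftrightarrow> neg v"
  by (auto simp: pos_def neg_def)

lemma pos_e [simp]: "pos (e s)"
  by (simp add: pos_def simple_root_apply)

lemma descent_neg:
  assumes "w \<in> W" "len (w \<circ> r s) \<le> len w"
  shows "neg (w (e s))"
proof -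
  have "w \<circ> r s \<circ> r s = w" by (simp add: comp_assoc)
  then have "0 \<le> (w \<circ> r s) (e s) k" for k
    using ascent_nonneg[of "w \<circ> r s" s k] assms by simp
  then show ?thesis using lin_minus[OF assms(1)] by (simp add: neg_def)
qed

lemma root_cases: "b \<in> roots \<Longrightarrow> pos b \<or> neg b"
  unfolding roots_def using ascent_nonneg descent_neg unfolding pos_def
  by (smt (verit) mem_Collect_eq nle_le)

lemma in_roots [simp]: "w \<in> W \<Longrightarrow> w (e s) \<in> roots"
  by (auto simp: roots_def)

lemma e_in_roots [simp]: "e s \<in> roots"
  using in_roots[OF cox_group.id] by simp

lemma roots_closed: "w \<in> W \<Longrightarrow> b \<in> roots \<Longrightarrow> w b \<in> roots"
  using comp_in[of w] in_roots[of "w \<circ> _"] by (auto simp: roots_def)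

lemma root_norm: "b \<in> roots \<Longrightarrow> form b b = 1"
  by (auto simp: roots_def form_inv)

lemma root_nonzero: "b \<in> roots \<Longrightarrow> \<exists>k. b k \<noteq> 0"
proof (rule ccontr)
  assume "b \<in> roots" "\<nexists>k. b k \<noteq> 0"
  then show False using root_norm[of b] by (simp add: form_def)
qed

lemma root_not_both: "b \<in> roots \<Longrightarrow> neg b \<longleftrightarrow> \<not> pos b"
  using root_nonzero[of b] root_cases[of b] unfolding pos_def neg_def by (metis order_antisym)

text \<open>\<open>r s\<close> changes only coordinate \<open>s\<close>. A positive root other than
  \<open>e s\<close> has norm one, hence another positive coordinate; that one survives and decides
  the sign.\<close>

lemma refl_root_pos:
  assumes "b \<in> roots" "pos b" "b \<noteq> e s"
  shows "pos (r s b)"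
proof -
  have "\<exists>t. t \<noteq> s \<and> b t > 0"
  proof (rule ccontr)
    assume "\<not> ?thesis"
    then have z: "t \<noteq> s \<Longrightarrow> b t = 0" for t using assms(2) by (force simp: pos_def intro: order_antisym)
    then have b: "b = (\<lambda>k. b s * e s k + 0 * e s k)" by (auto simp: simple_root_apply)
    have "form b b = b s * b s" by (subst (1) b, subst form_lin, subst form_e, subst b, subst pair_lin) simp
    then have "b s * b s = 1" using root_norm assms(1) by simp
    moreover have "b s \<ge> 0" using assms(2) by (simp add: pos_def)
    ultimately have "b s = 1" by (auto simp: square_eq_1_iff)
    then have "b = e s" by (subst b) simp
    then show False using assms(3) by simp
  qed
  then obtain t where t: "t \<noteq> s" "b t > 0" by blast
  then have "\<not> neg (r s b)" using refl_other[of t s b] by (metis neg_def not_le)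
  then show ?thesis using root_cases roots_closed[OF refl_in assms(1)] by blast
qed

text \<open>A nontrivial element has a descent, which makes some simple root negative.\<close>

lemma pos_imp_id:
  assumes "w \<in> W" "\<And>s. pos (w (e s))"
  shows "w = id"
proof (rule ccontr)
  assume "w \<noteq> id"
  then obtain t where "len w = Suc (len (w \<circ> r t))" using descent_exists assms(1) by blast
  then have "neg (w (e t))" using descent_neg assms(1) by simp
  then show False using assms root_not_both[of "w (e t)"] by simp
qed

end

section \<open>Coxeter elements\<close>

context finite_coxeter
begin

lemma word_other: "k \<notin> set xs \<Longrightarrow> word xs v k = v k"
  by (induction xs) (auto simp: refl_other)

lemma roots_minus: "b \<in> roots \<Longrightarrow> (\<lambda>k. - b k) \<in> roots"
proof -
  assume "b \<in> roots"
  then obtain w s where w: "w \<in> W" "b = w (e s)" by (auto simp: roots_def)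
  then have "(\<lambda>k. - b k) = (w \<circ> r s) (e s)" by (simp add: lin_minus)
  moreover have "(w \<circ> r s) (e s) \<in> roots"
    by (rule in_roots[OF comp_in[OF w(1) refl_in]])
  ultimately show ?thesis by simp
qed

text \<open>A new letter \<open>x\<close> in front creates exactly one inversion, the root
  \<open>?g\<close> that the remaining word sends to \<open>e x\<close>; it counts if
  \<open>e x\<close> lies in \<open>R\<close>. None is lost: a root sent to the negative of
  \<open>e x\<close> is the negative of \<open>?g\<close>, hence not positive.\<close>

lemma card_inversions:
  assumes "distinct xs" "R \<subseteq> roots" "finite R" "\<And>w b. w \<in> W \<Longrightarrow> b \<in> R \<Longrightarrow> w b \<in> R"
  shows "card {b \<in> R. pos b \<and> neg (word xs b)} = card {i \<in> set xs. e i \<in> R}"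
  using assms(1)
proof (induction xs)
  case Nil
  have "{b \<in> R. pos b \<and> neg (word [] b)} = {}" using root_not_both assms(2) by auto
  then show ?case by (simp only: list.set empty_iff simp_thms empty_def[symmetric] card.empty)
next
  case (Cons x xs)
  let ?c = "word xs"
  let ?g = "inv ?c (e x)"
  have gR: "?g \<in> R" if "e x \<in> R" using assms(4)[OF inv_in[OF word_in] that] .
  \<comment> \<open>The letters are distinct, so the inverse of \<open>?c\<close> does not involve
    \<open>r x\<close> and leaves coordinate \<open>x\<close> alone.\<close>
  have gx: "?g x = 1" using Cons.prems by (simp add: inv_word word_other simple_root_apply)
  have g_root: "?g \<in> roots" by simp
  have "\<not> neg ?g" using gx by (auto simp: neg_def intro!: exI[of _ x])
  then have gp: "pos ?g" using root_cases[OF g_root] by blast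
  have "{b \<in> R. pos b \<and> neg (word (x # xs) b)}
      = {b \<in> R. pos b \<and> neg (?c b)} \<union> (if e x \<in> R then {?g} else {})" (is "?L = ?M")
  proof (intro equalityI subsetI)
    fix b assume b: "b \<in> ?L"
    then have cb: "?c b \<in> R" "?c b \<in> roots" using assms(2,4) by auto
    show "b \<in> ?M"
    proof (cases "neg (?c b)")
      case False
      then have "pos (?c b)" using root_cases cb by blast
      moreover have "\<not> pos (r x (?c b))" using b root_not_both roots_closed[OF refl_in cb(2)] by auto
      ultimately have "?c b = e x" using refl_root_pos cb by blast
      then have "b = ?g" by (metis inv_apply(1) word_in)
      then show ?thesis using cb(1) \<open>?c b = e x\<close> by auto
    qed (use b in auto)
  next
    fix b assume b: "b \<in> ?M"
    show "b \<in> ?L"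
    proof (cases "b \<in> R \<and> pos b \<and> neg (?c b)")
      case True
      then have cb: "(\<lambda>k. - ?c b k) \<in> roots" using assms(2,4) by (intro roots_minus) auto
      have "(\<lambda>k. - ?c b k) \<noteq> e x"
      proof
        assume "(\<lambda>k. - ?c b k) = e x"
        then have "?g = (\<lambda>k. - inv ?c (?c b) k)" using lin_minus[OF inv_in[OF word_in]] by metis
        then show False using gx True by (auto simp: pos_def dest: spec[of _ x])
      qed
      then have "pos (r x (\<lambda>k. - ?c b k))" using refl_root_pos[OF cb] True by simp
      then show ?thesis using True lin_minus[OF refl_in] by simp
    next
      case False
      then have "b = ?g" "e x \<in> R" using b by (auto split: if_splits)
      then show ?thesis using gR gp by simp
    qed
  qed
  moreover have "\<not> neg (?c ?g)" using root_not_both[of "e x"] by simp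
  ultimately have "card ?L = card {b \<in> R. pos b \<and> neg (?c b)} + (if e x \<in> R then 1 else 0)"
    using assms(3) by (auto simp: card_insert_if)
  moreover have "{i \<in> set (x # xs). e i \<in> R} = (if e x \<in> R then {x} else {}) \<union> {i \<in> set xs. e i \<in> R}"
    by auto
  ultimately show ?case using Cons by (auto simp: card_insert_if)
qed

text \<open>If all vertices of \<open>T\<close> had degree at least two within \<open>T\<close>, the indicator vector of \<open>T\<close>
  would have nonpositive norm, as each edge contributes at most \<open>-1/2\<close> at both ends.\<close>
lemma leaf_exists:
  assumes "T \<noteq> {}"
  shows "\<exists>x\<in>T. \<exists>y. \<forall>j\<in>T. adj x j \<longrightarrow> j = y"
proof (rule ccontr)
  assume no: "\<not> ?thesis"
  define v :: "'i \<Rightarrow> real" where "v = (\<lambda>k. if k \<in> T then 1 else 0)"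
  have "v \<noteq> (\<lambda>_. 0)" using assms by (auto simp: v_def fun_eq_iff)
  then have "form v v > 0" by (rule form_pos)
  moreover have "form v v \<le> 0"
    unfolding form_def
  proof (rule sum_nonpos)
    fix s :: 'i
    show "v s * pair s v \<le> 0"
    proof (cases "s \<in> T")
      case True
      obtain j1 where j1: "j1 \<in> T" "adj s j1" using no True by blast
      obtain j2 where j2: "j2 \<in> T" "adj s j2" "j2 \<noteq> j1" using no True by blast
      have ne: "s \<noteq> j1" "s \<noteq> j2" using j1 j2 by (auto simp: adj_def)
      have "pair s v = (\<Sum>j\<in>T. B s j)"
        by (simp add: pair_def v_def if_distrib sum.If_cases cong: if_cong)
      also have "\<dots> = B s s + B s j1 + B s j2 + (\<Sum>j\<in>T - {s, j1, j2}. B s j)"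
      proof -
        have "(\<Sum>j\<in>T. B s j) = (\<Sum>j\<in>T - {s, j1, j2}. B s j) + (\<Sum>j\<in>{s, j1, j2}. B s j)"
          by (rule sum.subset_diff) (use True j1 j2 in auto)
        then show ?thesis using ne j2(3) by (simp add: add.assoc)
      qed
      also have "\<dots> \<le> 1 + (-1/2) + (-1/2) + 0"
        using B_adj[OF j1(2)] B_adj[OF j2(2)] by (intro add_mono sum_nonpos) (auto intro: B_nonpos)
      finally show ?thesis using True by (simp add: v_def)
    qed (simp add: v_def)
  qed
  ultimately show False by simp
qed

section \<open>Height functions and bipartite Coxeter elements\<close>

lemma height_exists:
  fixes R :: "'i \<Rightarrow> 'i \<Rightarrow> bool"
  assumes asym: "\<And>i j. R i j \<Longrightarrow> \<not> R j i"
  shows "\<exists>\<tau> :: 'i \<Rightarrow> int. \<forall>i\<in>T. \<forall>j\<in>T. adj i j \<longrightarrow> R i j \<longrightarrow> \<tau> j = \<tau> i + 1"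
\<comment> \<open>Remove a leaf \<open>x\<close>: its only possible neighbour \<open>y\<close> in
  the rest determines its height.\<close>
proof (induction "card T" arbitrary: T rule: less_induct)
  case less
  show ?case
  proof (cases "T = {}")
    case False
    then obtain x where x1: "x \<in> T" and "\<exists>y. \<forall>j\<in>T. adj x j \<longrightarrow> j = y"
      using leaf_exists[OF False] by (elim bexE)
    then obtain y where x: "x \<in> T" "\<And>j. j \<in> T \<Longrightarrow> adj x j \<Longrightarrow> j = y" by blast
    have "card (T - {x}) < card T" by (rule card_Diff1_less[OF finite x(1)])
    then obtain \<tau> :: "'i \<Rightarrow> int"
      where t: "\<forall>i\<in>T - {x}. \<forall>j\<in>T - {x}. adj i j \<longrightarrow> R i j \<longrightarrow> \<tau> j = \<tau> i + 1"
      using less[of "T - {x}"] by auto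
    \<comment> \<open>If \<open>x\<close> has no neighbour in \<open>T\<close>, either value will
      do.\<close>
    let ?t = "\<tau>(x := if R x y then \<tau> y - 1 else \<tau> y + 1)"
    have nx: "\<not> adj i i" for i by (simp add: adj_def)
    show ?thesis
    proof (intro exI[of _ ?t] ballI impI)
      fix i j assume ij: "i \<in> T" "j \<in> T" "adj i j" "R i j"
      show "?t j = ?t i + 1"
        using ij t x(2)[of i] x(2)[of j] adj_sym[of i j] asym[of i j] nx
        by (cases "i = x"; cases "j = x") auto
    qed
  qed simp
qed

text \<open>Orient each edge by the order of its ends in \<open>ss\<close> and apply
  \<open>height_exists\<close>.\<close>

lemma height_order_exists:
  assumes "distinct ss"
  shows "\<exists>\<tau> :: 'i \<Rightarrow> int. sorted_wrt (\<lambda>i j. adj i j \<longrightarrow> \<tau> j = \<tau> i + 1) ss"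
proof -
  define R where "R i j \<longleftrightarrow> (\<exists>a b. a < b \<and> b < length ss \<and> ss ! a = i \<and> ss ! b = j)" for i j
  have "\<not> R j i" if "R i j" for i j
    using that assms unfolding R_def
    by (smt (verit) nth_eq_iff_index_eq order_less_trans less_asym)
  from height_exists[of R UNIV, OF this] obtain \<tau> :: "'i \<Rightarrow> int"
    where "\<forall>i\<in>UNIV. \<forall>j\<in>UNIV. adj i j \<longrightarrow> R i j \<longrightarrow> \<tau> j = \<tau> i + 1" by blast
  then show ?thesis
    by (intro exI[of _ \<tau>]) (auto simp: sorted_wrt_iff_nth_less R_def)
qed

definition independent :: "'i set \<Rightarrow> bool" where
  "independent A \<longleftrightarrow> (\<forall>i\<in>A. \<forall>j\<in>A. \<not> adj i j)"

lemma word_commute: "x \<notin> set xs \<Longrightarrow> (\<And>y. y \<in> set xs \<Longrightarrow> \<not> adj x y) \<Longrightarrow> r x \<circ> word xs = word xs \<circ> r x"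
proof (induction xs)
  case (Cons y xs)
  have "r x \<circ> word (y # xs) = (r x \<circ> r y) \<circ> word xs" by (simp add: comp_assoc)
  also have "\<dots> = r y \<circ> (r x \<circ> word xs)" using Cons.prems by (subst refl_commute) (auto simp: comp_assoc)
  also have "r x \<circ> word xs = word xs \<circ> r x" by (rule Cons.IH) (use Cons.prems in auto)
  finally show ?case by (simp add: comp_assoc)
qed simp

text \<open>Letters in \<open>P\<close> move left past the others; by hypothesis no such exchange
  involves adjacent vertices, so the letters commute.\<close>

lemma word_partition:
  assumes "distinct xs" "sorted_wrt (\<lambda>i j. adj i j \<longrightarrow> \<not> (\<not> P i \<and> P j)) xs"
  shows "word xs = word (filter P xs @ filter (\<lambda>x. \<not> P x) xs)"
  using assms
proof (induction xs)
  case (Cons x xs)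
  show ?case
  proof (cases "P x")
    case False
    have "r x \<circ> word (filter P xs) = word (filter P xs) \<circ> r x"
      by (rule word_commute) (use Cons.prems False in auto)
    then have "r x (word (filter P xs) v) = word (filter P xs) (r x v)" for v
      by (metis comp_apply)
    moreover have "word xs v = word (filter P xs) (word (filter (\<lambda>x. \<not> P x) xs) v)" for v
      using Cons by simp
    ultimately show ?thesis using False by (intro ext) simp
  qed (use Cons in \<open>simp add: comp_assoc\<close>)
qed simp

lemma elem_order_conj:
  fixes g c :: "'a \<Rightarrow> 'a"
  assumes "g \<circ> g = id"
  shows "elem_order (g \<circ> c \<circ> g) = elem_order c"
proof -
  have p: "(g \<circ> c \<circ> g) ^^ k = g \<circ> c ^^ k \<circ> g" for k
    by (induction k) (use assms in \<open>auto simp: fun_eq_iff\<close>)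
  have "g \<circ> d \<circ> g = id \<longleftrightarrow> d = id" for d
    using assms by (metis comp_assoc comp_id id_comp)
  then show ?thesis unfolding elem_order_def p by simp
qed

text \<open>Rotating a vertex of minimal height to the end of the word conjugates the Coxeter element and
  raises that vertex by two; this is repeated until only two heights remain.\<close>
lemma bipartite_order_aux:
  fixes \<tau> :: "'i \<Rightarrow> int"
  assumes "distinct ss" "set ss = UNIV" "sorted_wrt (\<lambda>i j. adj i j \<longrightarrow> \<tau> j = \<tau> i + 1) ss"
    and "\<And>i. \<tau> i \<le> M"
  shows "\<exists>as bs. distinct (as @ bs) \<and> set (as @ bs) = UNIV \<and> as \<noteq> [] \<and> independent (set as)
    \<and> independent (set bs) \<and> elem_order (word ss) = elem_order (word (as @ bs))"
  using assms
proof (induction "nat (\<Sum>i\<in>UNIV. M - \<tau> i)" arbitrary: ss \<tau> rule: less_induct)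
  case less
  define a where "a = Min (range \<tau>)"
  have amin: "a \<le> \<tau> i" for i by (simp add: a_def)
  have "a \<in> range \<tau>" unfolding a_def by (rule Min_in) auto
  then obtain x where x: "\<tau> x = a" by auto
  show ?case
  proof (cases "a + 2 \<le> M")
    case True
    obtain xs ys where ss: "ss = xs @ x # ys" using less.prems(2) by (metis UNIV_I split_list)
    let ?t = "\<tau>(x := \<tau> x + 2)"
    let ?ss = "(xs @ ys) @ [x]"
    \<comment> \<open>A neighbour in front of \<open>x\<close> would lie below the minimal
      height.\<close>
    have xs: "\<not> adj x y" if "y \<in> set xs" for y
    proof
      assume "adj x y"
      then have "\<tau> x = \<tau> y + 1" using less.prems(3) that adj_sym unfolding ss sorted_wrt_append by auto
      then show False using amin[of y] x by simp
    qed
    have "word ss = (word xs \<circ> r x) \<circ> word ys" by (simp add: ss comp_assoc)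
    also have "word xs \<circ> r x = r x \<circ> word xs"
      using word_commute[of x xs] xs less.prems(1) ss by auto
    finally have "word ss = r x \<circ> word ?ss \<circ> r x" by (auto simp: fun_eq_iff)
    then have ord: "elem_order (word ss) = elem_order (word ?ss)"
      using elem_order_conj[of "r x" "word ?ss"] by simp
    have "sorted_wrt (\<lambda>i j. adj i j \<longrightarrow> ?t j = ?t i + 1) (xs @ ys)"
      by (rule sorted_wrt_mono_rel[of _ "\<lambda>i j. adj i j \<longrightarrow> \<tau> j = \<tau> i + 1"])
        (use less.prems(1,3) ss in \<open>auto simp: sorted_wrt_append\<close>)
    \<comment> \<open>Neighbours of \<open>x\<close> have height \<open>a + 1\<close>; raised to
      \<open>a + 2\<close>, \<open>x\<close> lies one above the neighbours it now follows.\<close>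
    moreover have "?t x = ?t y + 1" if "y \<in> set (xs @ ys)" "adj y x" for y
    proof -
      have "y \<in> set ys" using that xs adj_sym by auto
      then have "\<tau> y = \<tau> x + 1" using less.prems(3) adj_sym[OF that(2)] unfolding ss sorted_wrt_append by auto
      then show ?thesis using less.prems(1) ss that by auto
    qed
    ultimately have srt: "sorted_wrt (\<lambda>i j. adj i j \<longrightarrow> ?t j = ?t i + 1) ?ss"
      unfolding sorted_wrt_append by auto
    have le: "?t i \<le> M" for i using less.prems(4) x True by simp
    \<comment> \<open>The sum of the gaps below \<open>M\<close> is the termination measure.\<close>
    have s1: "(\<Sum>i\<in>UNIV. M - ?t i) < (\<Sum>i\<in>UNIV. M - \<tau> i)"
      by (rule sum_strict_mono_ex1) auto
    have s2: "0 \<le> (\<Sum>i\<in>UNIV. M - ?t i)"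
      by (rule sum_nonneg) (use le in \<open>simp only: diff_ge_0_iff_ge\<close>)
    have "nat (\<Sum>i\<in>UNIV. M - ?t i) < nat (\<Sum>i\<in>UNIV. M - \<tau> i)" using s1 s2 by linarith
    from less.hyps[OF this _ _ srt le] less.prems(1,2) ord show ?thesis by (auto simp: ss)
  next
    case False
    let ?P = "\<lambda>i. \<tau> i = a"
    have "x \<in> set (filter ?P ss)" using x less.prems(2) by simp
    then have ne: "filter ?P ss \<noteq> []" by (metis empty_iff empty_set)
    have diff: "\<tau> i \<noteq> \<tau> j" if "adj i j" for i j
    proof -
      obtain p q where pq: "ss ! p = i" "ss ! q = j" "p < length ss" "q < length ss"
        using less.prems(2) by (metis UNIV_I in_set_conv_nth)
      have "p \<noteq> q" using that pq by (auto simp: adj_def)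
      then show ?thesis using less.prems(3) pq that adj_sym
        unfolding sorted_wrt_iff_nth_less by (metis less_add_one less_irrefl linorder_neqE_nat)
    qed
    have two: "\<tau> i = a + 1" if "\<tau> i \<noteq> a" for i
      using False less.prems(4)[of i] amin[of i] that by linarith
    \<comment> \<open>Only the heights \<open>a\<close> and \<open>a + 1\<close> remain and
      neighbours differ in height, so the level sets are the two colours; of two neighbours the
      lower already comes first.\<close>
    have "word ss = word (filter ?P ss @ filter (\<lambda>x. \<not> ?P x) ss)"
    proof (rule word_partition[OF less.prems(1)], rule sorted_wrt_mono_rel[OF _ less.prems(3)])
      show "adj i j \<longrightarrow> \<not> (\<tau> i \<noteq> a \<and> \<tau> j = a)" if "adj i j \<longrightarrow> \<tau> j = \<tau> i + 1" for i j
        using that amin[of i] by auto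
    qed
    moreover have "independent (set (filter ?P ss))" "independent (set (filter (\<lambda>x. \<not> ?P x) ss))"
      unfolding independent_def using diff two by (simp; metis)+
    ultimately show ?thesis using ne less.prems(1,2)
      by (intro exI[of _ "filter ?P ss"] exI[of _ "filter (\<lambda>x. \<not> ?P x) ss"]) auto
  qed
qed

lemma bipartite_order:
  assumes "distinct ss" "set ss = UNIV"
  shows "\<exists>as bs. distinct (as @ bs) \<and> set (as @ bs) = UNIV \<and> as \<noteq> [] \<and> independent (set as)
    \<and> independent (set bs) \<and> elem_order (word ss) = elem_order (word (as @ bs))"
proof -
  obtain \<tau> :: "'i \<Rightarrow> int" where "sorted_wrt (\<lambda>i j. adj i j \<longrightarrow> \<tau> j = \<tau> i + 1) ss"
    using height_order_exists assms(1) by blast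
  then show ?thesis using bipartite_order_aux[OF assms, of \<tau> "Max (range \<tau>)"] by simp
qed

end

section \<open>The Coxeter plane\<close>

lemma quadratic_nonneg_imp_linear_zero:
  fixes a b :: real
  assumes "\<And>t. 0 \<le> 2 * t * a + t\<^sup>2 * b"
  shows "a = 0"
proof (rule ccontr)
  assume "a \<noteq> 0"
  define c where "c = \<bar>b\<bar> + 1"
  have c: "c > 0" "b < c" by (auto simp: c_def)
  \<comment> \<open>As \<open>c\<close> exceeds \<open>b\<close>, the linear term wins at this point
    and the value is negative.\<close>
  have "0 \<le> 2 * (- a / c) * a + (- a / c)\<^sup>2 * b" by (rule assms)
  also have "\<dots> = a\<^sup>2 / c * (b / c - 2)"
    using c by (simp add: field_simps power2_eq_square)
  finally have "0 \<le> a\<^sup>2 / c * (b / c - 2)" .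
  moreover have "a\<^sup>2 / c > 0" using c \<open>a \<noteq> 0\<close> by simp
  moreover have "b / c - 2 < 0" using c by (simp add: field_simps)
  ultimately show False by (meson mult_pos_neg not_le)
qed

text \<open>For the least \<open>N\<close> with N\<theta> \<ge> pi, the angle (2N - 1)\<theta> lies
  within \<theta> of 2 pi, yet its cosine is at most cos \<theta>. This leaves only the end point,
  N\<theta> = pi.\<close>

lemma angle_rigidity:
  assumes "0 < \<theta>" "\<theta> \<le> pi / 2" and le: "\<And>j :: int. cos ((4 * j - 1) * \<theta>) \<le> cos \<theta>"
  shows "\<exists>M :: nat. M \<ge> 2 \<and> \<theta> = pi / real M"
proof -
  define N where "N = \<lceil>pi / \<theta>\<rceil>"
  have "pi / \<theta> \<le> of_int N" "of_int N - 1 < pi / \<theta>" unfolding N_def by linarith+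
  then have N: "pi \<le> of_int N * \<theta>" "(of_int N - 1) * \<theta> < pi" using assms(1) by (simp_all add: field_simps)
  \<comment> \<open>Up to sign, 2N - 1 has the form 4j - 1 for either parity of
    \<open>N\<close>.\<close>
  have "cos ((2 * of_int N - 1) * \<theta>) \<le> cos \<theta>"
  proof (cases "even N")
    case True
    then obtain j where "N = 2 * j" by (elim evenE)
    then show ?thesis using le[of j] by simp
  next
    case False
    then obtain j where "N = 2 * j + 1" by (elim oddE)
    then have eq: "(4 * of_int (- j) - 1) * \<theta> = - ((2 * of_int N - 1) * \<theta>)"
      by (simp add: algebra_simps)
    show ?thesis using le[of "- j"] unfolding eq cos_minus .
  qed
  moreover define \<phi> where "\<phi> = (2 * of_int N - 1) * \<theta> - 2 * pi"
  have "cos \<phi> = cos ((2 * of_int N - 1) * \<theta>)" by (simp add: \<phi>_def cos_diff)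
  ultimately have c: "cos \<bar>\<phi>\<bar> \<le> cos \<theta>" by simp
  have ph: "- \<theta> \<le> \<phi>" "\<phi> < \<theta>" using N by (simp_all add: \<phi>_def algebra_simps)
  have "\<phi> = - \<theta>"
  proof (rule ccontr)
    assume "\<phi> \<noteq> - \<theta>"
    then have "\<bar>\<phi>\<bar> < \<theta>" using ph by auto
    then have "cos \<theta> < cos \<bar>\<phi>\<bar>" using assms(2) pi_gt_zero by (intro cos_monotone_0_pi) auto
    then show False using c by simp
  qed
  then have Nt: "of_int N * \<theta> = pi" by (simp add: \<phi>_def algebra_simps)
  have "2 \<le> pi / \<theta>" using assms(1,2) by (simp add: field_simps)
  then have "N \<ge> 2" unfolding N_def by linarith
  moreover have "\<theta> = pi / nat N" using Nt assms(1) \<open>N \<ge> 2\<close> by (auto simp: field_simps)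
  ultimately show ?thesis by (intro exI[of _ "nat N"]) auto
qed

lemma sin_2pi_frac: "sin (2 * pi * x) = sin (2 * pi * frac x)"
proof -
  have "2 * pi * x = 2 * pi * frac x + 2 * pi * \<lfloor>x\<rfloor>" by (simp add: frac_def algebra_simps)
  then show ?thesis by (simp add: sin_add)
qed

lemma sin_2pi_pos_iff:
  assumes "sin (2 * pi * x) \<noteq> 0"
  shows "sin (2 * pi * x) > 0 \<longleftrightarrow> frac x < 1 / 2"
proof (cases "frac x < 1 / 2")
  case True
  have "0 \<le> sin (2 * pi * frac x)" using True frac_ge_0[of x] by (intro sin_ge_zero) auto
  then show ?thesis using True assms by (simp add: sin_2pi_frac[of x])
next
  case False
  have "sin (2 * pi * frac x) \<le> 0"
    using False frac_lt_1[of x] by (intro sin_le_zero) (auto simp: field_simps)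
  then show ?thesis using False by (simp add: sin_2pi_frac[of x])
qed

text \<open>The sign falls from positive to negative exactly when z - k/M steps down across an
  integer, as a step is at most half a turn. The drops of the floor telescope to one over a full
  turn.\<close>

lemma rotation_sign_changes:
  fixes M :: nat
  assumes "M \<ge> 2" and nz: "\<And>k :: nat. sin (2 * pi * (z - k / M)) \<noteq> 0"
  shows "card {k. k < M \<and> sin (2 * pi * (z - k / M)) > 0 \<and> sin (2 * pi * (z - Suc k / M)) < 0} = 1"
proof -
  define f where "f k = \<lfloor>z - real k / M\<rfloor>" for k :: nat
  have "(if sin (2 * pi * (z - k / M)) > 0 \<and> sin (2 * pi * (z - Suc k / M)) < 0 then 1 else 0)
      = f k - f (Suc k)" for k :: nat
  proof -
    define x where "x = z - k / M"
    define d where "d = 1 / real M"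
    have d: "0 < d" "d \<le> 1 / 2" using assms(1) by (auto simp: d_def field_simps)
    have y: "z - Suc k / M = x - d" by (simp add: x_def d_def add_divide_distrib)
    have nx: "sin (2 * pi * x) \<noteq> 0" "sin (2 * pi * (x - d)) \<noteq> 0"
      using nz[of k] nz[of "Suc k"] unfolding y by (auto simp: x_def)
    have iff: "sin (2 * pi * x) > 0 \<and> sin (2 * pi * (x - d)) < 0 \<longleftrightarrow> frac x < 1 / 2 \<and> \<not> frac (x - d) < 1 / 2"
      using sin_2pi_pos_iff nx by (metis linorder_neqE_linordered_idom order_less_asym)
    have "frac x < 1 / 2 \<and> \<not> frac (x - d) < 1 / 2 \<longleftrightarrow> frac x < d"
      and "\<lfloor>x\<rfloor> - \<lfloor>x - d\<rfloor> = (if frac x < d then 1 else 0)"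
    proof -
      have fr: "0 \<le> frac x" "frac x < 1" by (auto simp: frac_lt_1)
      have x: "x = \<lfloor>x\<rfloor> + frac x" by (simp add: frac_def)
      have fl: "\<lfloor>x - d\<rfloor> = (if frac x < d then \<lfloor>x\<rfloor> - 1 else \<lfloor>x\<rfloor>)"
        using d fr x by (cases "frac x < d"; simp only: if_True if_False; intro floor_unique;
            simp only: of_int_diff of_int_1; linarith)
      then show "\<lfloor>x\<rfloor> - \<lfloor>x - d\<rfloor> = (if frac x < d then 1 else 0)" by simp
      have "frac (x - d) = (if frac x < d then frac x - d + 1 else frac x - d)"
        unfolding frac_def[of "x - d"] fl using x by auto
      then show "frac x < 1 / 2 \<and> \<not> frac (x - d) < 1 / 2 \<longleftrightarrow> frac x < d"
        using d fr by (smt (verit) field_sum_of_halves)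
    qed
    then show ?thesis using iff unfolding y f_def x_def[symmetric] by simp
  qed
  then have "(\<Sum>k<M. if sin (2 * pi * (z - k / M)) > 0 \<and> sin (2 * pi * (z - Suc k / M)) < 0 then 1 else 0)
      = f 0 - f M" by (simp add: sum_lessThan_telescope')
  also have "f 0 - f M = 1" using assms(1) by (simp add: f_def)
  finally show ?thesis by (simp add: sum.If_cases Int_def)
qed

section \<open>The Perron vector of the Coxeter graph\<close>

context finite_coxeter
begin

lemma form_scale: "form (\<lambda>k. c * v k) (\<lambda>k. c * v k) = c\<^sup>2 * form v v"
  by (simp add: form_def pair_scale sum_distrib_left power2_eq_square algebra_simps)

text \<open>Minimise on the unit sphere by compactness. Taking absolute values does not increase
  \<open>form\<close>, as \<open>B\<close> is nonpositive off the diagonal.\<close>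

lemma form_minimizer:
  obtains p :: "'i \<Rightarrow> real" where "(\<Sum>k\<in>UNIV. (p k)\<^sup>2) = 1" "\<And>k. 0 \<le> p k"
    "\<And>v. form p p * (\<Sum>k\<in>UNIV. (v k)\<^sup>2) \<le> form v v"
proof -
  define f :: "real^'i \<Rightarrow> real" where "f x = form (\<lambda>k. x $ k) (\<lambda>k. x $ k)" for x
  have cont: "continuous_on (sphere 0 1) f"
    unfolding f_def form_def pair_def by (intro continuous_intros)
  obtain i :: 'i where True by simp
  have "axis i 1 \<in> sphere (0 :: real^'i) 1" by simp
  then have "sphere (0 :: real^'i) 1 \<noteq> {}" by blast
  then obtain x where x: "x \<in> sphere 0 1" "\<And>y. y \<in> sphere 0 1 \<Longrightarrow> f x \<le> f y"
    using continuous_attains_inf[OF compact_sphere _ cont] by blast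
  have nrm: "norm y = 1 \<longleftrightarrow> (\<Sum>k\<in>UNIV. (y $ k)\<^sup>2) = 1" for y :: "real^'i"
    by (simp add: norm_eq_1 inner_vec_def power2_eq_square)
  have low: "f x * (\<Sum>k\<in>UNIV. (v k)\<^sup>2) \<le> form v v" for v
  proof (cases "(\<Sum>k\<in>UNIV. (v k)\<^sup>2) = 0")
    case True
    then have "v = (\<lambda>_. 0)" by (auto simp: sum_nonneg_eq_0_iff)
    then show ?thesis using True by (simp add: form_def)
  next
    case False
    define S where "S = (\<Sum>k\<in>UNIV. (v k)\<^sup>2)"
    have S: "S > 0" using False by (simp add: S_def sum_nonneg order_less_le)
    define y :: "real^'i" where "y = (\<chi> k. (1 / sqrt S) * v k)"
    have "(\<Sum>k\<in>UNIV. (y $ k)\<^sup>2) = 1"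
      using S by (simp add: y_def power_mult_distrib power_divide sum_divide_distrib[symmetric] S_def[symmetric])
    then have "f x \<le> f y" using nrm[of y] by (intro x(2)) simp
    also have "f y = form (\<lambda>k. (1 / sqrt S) * v k) (\<lambda>k. (1 / sqrt S) * v k)"
    proof -
      have "($) y = (\<lambda>k. (1 / sqrt S) * v k)" by (simp add: fun_eq_iff y_def)
      then show ?thesis by (simp only: f_def)
    qed
    also have "\<dots> = (1 / sqrt S)\<^sup>2 * form v v" by (rule form_scale)
    also have "\<dots> = form v v / S" using S by (simp add: power_divide)
    finally show ?thesis using S by (simp add: S_def[symmetric] field_simps)
  qed
  define p where "p k = \<bar>x $ k\<bar>" for k
  have sp: "(\<Sum>k\<in>UNIV. (p k)\<^sup>2) = 1" using x(1) nrm[of x] by (simp add: p_def)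
  have "form p p \<le> f x"
    unfolding form_def pair_def f_def sum_distrib_left
  proof (intro sum_mono)
    fix s j
    show "p s * (B s j * p j) \<le> x $ s * (B s j * x $ j)"
    proof (cases "s = j")
      case False
      have "x $ s * x $ j \<le> p s * p j" unfolding p_def abs_mult[symmetric] by simp
      then have "B s j * (p s * p j) \<le> B s j * (x $ s * x $ j)"
        using B_nonpos[OF False] by (rule mult_left_mono_neg)
      then show ?thesis by (simp add: mult_ac)
    qed (simp add: p_def)
  qed
  then have "form p p = f x" using low[of p] sp by simp
  then show thesis using that[of p] sp low by (simp add: p_def)
qed

text \<open>The minimiser is an eigenvector for the least eigenvalue \<mu> of \<open>B\<close>; cos
  \<theta> = 1 - \<mu> is the Perron eigenvalue of the nonnegative matrix I - B.\<close>

lemma perron_vector: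
  obtains p :: "'i \<Rightarrow> real" and \<theta> :: real where "\<And>i. 0 < p i" "0 < \<theta>" "\<theta> \<le> pi / 2"
    "\<And>i. pair i p = (1 - cos \<theta>) * p i"
proof -
  obtain p :: "'i \<Rightarrow> real" where p: "(\<Sum>k\<in>UNIV. (p k)\<^sup>2) = 1" "\<And>k. 0 \<le> p k"
    "\<And>v. form p p * (\<Sum>k\<in>UNIV. (v k)\<^sup>2) \<le> form v v" by (rule form_minimizer) (rule that)
  define \<mu> where "\<mu> = form p p"
  have eig: "pair i p = \<mu> * p i" for i
  proof -
    \<comment> \<open>First variation at the minimum in the direction \<open>e i\<close>.\<close>
    have "0 \<le> 2 * t * (pair i p - \<mu> * p i) + t\<^sup>2 * (1 - \<mu>)" for t
    proof -
      let ?v = "\<lambda>k. 1 * p k + t * e i k"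
      have "form ?v ?v = form p ?v + t * pair i ?v" unfolding form_lin by simp
      also have "form p ?v = \<mu> + t * pair i p"
        unfolding form_sym[of p ?v] form_lin by (simp add: \<mu>_def)
      also have "pair i ?v = pair i p + t" unfolding pair_lin by simp
      finally have 1: "form ?v ?v = \<mu> + 2 * t * pair i p + t\<^sup>2"
        by (simp add: algebra_simps power2_eq_square)
      have "(\<Sum>k\<in>UNIV. (?v k)\<^sup>2) = (\<Sum>k\<in>UNIV. (p k)\<^sup>2 + (2 * t * p k) * e i k + (t\<^sup>2 * e i k) * e i k)"
        by (intro sum.cong) (auto simp: power2_eq_square algebra_simps)
      also have "\<dots> = 1 + 2 * t * p i + t\<^sup>2"
        unfolding sum.distrib p(1) sum_simple_root by (simp add: simple_root_apply)
      finally show ?thesis using p(3)[of ?v] 1 by (simp add: \<mu>_def[symmetric] algebra_simps)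
    qed
    then have "pair i p - \<mu> * p i = 0" by (rule quadratic_nonneg_imp_linear_zero)
    then show ?thesis by simp
  qed
  have pair_le: "pair i p = p i + (\<Sum>j\<in>UNIV - {i}. B i j * p j)" for i
    by (simp add: pair_def sum.remove[of UNIV i])
  have np: "(\<Sum>j\<in>UNIV - {i}. B i j * p j) \<le> 0" for i
    by (rule sum_nonpos) (use p(2) B_nonpos in \<open>auto intro!: mult_nonpos_nonneg\<close>)
  have pos: "0 < p i" for i
  proof (rule ccontr)
    assume "\<not> 0 < p i"
    then have "p i = 0" using p(2)[of i] by simp
    \<comment> \<open>A zero entry forces zeros at its neighbours, since the off-diagonal terms all
      have the same sign.\<close>
    have "p j = 0" for j
    proof (rule connected_induct[of "\<lambda>j. p j = 0" i])
      fix i j assume a: "adj i j" and i: "p i = 0"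
      have "(\<Sum>j\<in>UNIV - {i}. - (B i j * p j)) = 0"
        using pair_le[of i] eig[of i] i by (simp add: sum_negf)
      then have "\<forall>j\<in>UNIV - {i}. - (B i j * p j) = 0"
        by (subst (asm) sum_nonneg_eq_0_iff) (use p(2) B_nonpos in \<open>auto intro!: mult_nonpos_nonneg\<close>)
      moreover have "j \<in> UNIV - {i}" using a by (auto simp: adj_def)
      ultimately have "B i j * p j = 0" by fastforce
      then show "p j = 0" using B_adj[OF a] by auto
    qed (rule \<open>p i = 0\<close>)
    then show False using p(1) by simp
  qed
  obtain i :: 'i where True by simp
  have "p \<noteq> (\<lambda>_. 0)" using p(1) by auto
  then have mu0: "0 < \<mu>" unfolding \<mu>_def by (rule form_pos)
  have "\<mu> * p i \<le> 1 * p i" using eig[of i] pair_le[of i] np[of i] by simp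
  then have mu1: "\<mu> \<le> 1" using pos[of i] by simp
  have c: "cos (arccos (1 - \<mu>)) = 1 - \<mu>" using mu0 mu1 by (intro cos_arccos) auto
  have "arccos (1 - \<mu>) \<noteq> 0" using c mu0 by auto
  moreover have "0 \<le> arccos (1 - \<mu>)" "arccos (1 - \<mu>) \<le> pi / 2"
    using mu0 mu1 arccos_lbound[of "1 - \<mu>"] arccos_le_pi2[of "1 - \<mu>"] by auto
  ultimately show thesis using that[of p "arccos (1 - \<mu>)"] pos eig c by simp
qed

end

section \<open>Projection to the Coxeter plane\<close>

locale coxeter_plane = finite_coxeter m for m :: "'i::finite \<Rightarrow> 'i \<Rightarrow> nat" +
  fixes as bs :: "'i list" and p :: "'i \<Rightarrow> real" and \<theta> :: real
  assumes dist: "distinct (as @ bs)" and all: "set (as @ bs) = UNIV" and nonempty: "as \<noteq> []"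
    and indep: "independent (set as)" "independent (set bs)"
    and p_pos: "\<And>i. 0 < p i" and theta: "0 < \<theta>" "\<theta> \<le> pi / 2"
    and eigen: "\<And>i. pair i p = (1 - cos \<theta>) * p i"
begin

definition wsum :: "'i set \<Rightarrow> ('i \<Rightarrow> real) \<Rightarrow> real" where
  "wsum A v = (\<Sum>i\<in>A. p i * v i)"

text \<open>Coordinates on the Coxeter plane: simple roots of the two colours point in the directions
  \<open>\<plusminus>(\<pi> - \<theta>)/2\<close>, so positive roots lie in the sector between these.\<close>
definition K :: "('i \<Rightarrow> real) \<Rightarrow> complex" where
  "K v = Complex (sin (\<theta> / 2) * (wsum (set as) v + wsum (set bs) v))
                 (cos (\<theta> / 2) * (wsum (set as) v - wsum (set bs) v))"

definition c :: "('i \<Rightarrow> real) \<Rightarrow> 'i \<Rightarrow> real" where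
  "c = word (as @ bs)"

lemma c_in [simp]: "c \<in> W"
  unfolding c_def by (rule word_in)

text \<open>Distinct vertices of an independent set pair to zero, so each reflection leaves the
  pairings used by the others unchanged.\<close>

lemma word_independent:
  "distinct xs \<Longrightarrow> independent (set xs) \<Longrightarrow> word xs v k = (if k \<in> set xs then r k v k else v k)"
proof (induction xs arbitrary: k)
  case (Cons x xs)
  have IH: "word xs v k = (if k \<in> set xs then r k v k else v k)" for k
    using Cons by (simp add: independent_def)
  show ?case
  proof (cases "k = x")
    case True
    have "pair x (word xs v) = pair x v"
      unfolding pair_def
    proof (intro sum.cong refl)
      fix j
      show "B x j * word xs v j = B x j * v j"
        using Cons.prems IH[of j] B_nonadj[of x j] by (auto simp: independent_def)
    qed
    then show ?thesis using True IH[of x] Cons.prems by (simp add: refl_self)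
  qed (simp add: refl_other IH)
qed simp

text \<open>On an independent set \<open>B\<close> is the identity. For \<open>j\<close> outside
  \<open>A\<close>, the complement contributes \<open>p j\<close> to the eigenvector equation, which
  leaves \<open>- cos \<theta> * p j\<close> for \<open>A\<close>.\<close>

lemma wsum_pair:
  assumes "independent A" "independent (- A)"
  shows "(\<Sum>i\<in>A. p i * pair i v) = wsum A v - cos \<theta> * wsum (- A) v"
proof -
  have colsum: "(\<Sum>i\<in>C. B j i * p i) = p j" if "independent C" "j \<in> C" for C j
  proof -
    have "(\<Sum>i\<in>C. B j i * p i) = (\<Sum>i\<in>C. if i = j then p j else 0)"
      using that B_nonadj[of j] by (intro sum.cong refl) (auto simp: independent_def)
    then show ?thesis using that(2) by simp
  qed
  have "(\<Sum>i\<in>A. p i * pair i v) = (\<Sum>j\<in>UNIV. v j * (\<Sum>i\<in>A. B j i * p i))"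
    unfolding pair_def sum_distrib_left by (subst sum.swap) (simp add: B_sym mult_ac)
  also have "\<dots> = (\<Sum>j\<in>A. v j * (\<Sum>i\<in>A. B j i * p i)) + (\<Sum>j\<in>- A. v j * (\<Sum>i\<in>A. B j i * p i))"
    using sum.subset_diff[of A UNIV "\<lambda>j. v j * (\<Sum>i\<in>A. B j i * p i)"]
    by (simp add: Compl_eq_Diff_UNIV)
  also have "(\<Sum>j\<in>A. v j * (\<Sum>i\<in>A. B j i * p i)) = wsum A v"
    unfolding wsum_def by (intro sum.cong refl) (simp add: colsum[OF assms(1)])
  also have "(\<Sum>j\<in>- A. v j * (\<Sum>i\<in>A. B j i * p i)) = (\<Sum>j\<in>- A. - cos \<theta> * (p j * v j))"
  proof (intro sum.cong refl)
    fix j assume j: "j \<in> - A"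
    have "pair j p = (\<Sum>i\<in>A. B j i * p i) + (\<Sum>i\<in>- A. B j i * p i)"
      unfolding pair_def using sum.subset_diff[of A UNIV "\<lambda>i. B j i * p i"]
      by (simp add: Compl_eq_Diff_UNIV)
    then have "(\<Sum>i\<in>A. B j i * p i) = - cos \<theta> * p j"
      using colsum[OF assms(2) j] eigen[of j] by (simp add: algebra_simps)
    then show "v j * (\<Sum>i\<in>A. B j i * p i) = - cos \<theta> * (p j * v j)" by simp
  qed
  finally show ?thesis by (simp add: wsum_def sum_distrib_left sum_negf)
qed

lemma wsum_word:
  assumes "distinct xs" "independent (set xs)" "independent (- set xs)"
  shows "wsum (set xs) (word xs v) = - wsum (set xs) v + 2 * cos \<theta> * wsum (- set xs) v"
    and "wsum (- set xs) (word xs v) = wsum (- set xs) v"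
proof -
  have "wsum (set xs) (word xs v) = (\<Sum>i\<in>set xs. p i * v i - 2 * (p i * pair i v))"
    unfolding wsum_def
    by (intro sum.cong refl) (simp add: word_independent[OF assms(1,2)] refl_self algebra_simps)
  also have "\<dots> = wsum (set xs) v - 2 * (\<Sum>i\<in>set xs. p i * pair i v)"
    by (simp add: wsum_def sum_subtractf sum_distrib_left)
  finally show "wsum (set xs) (word xs v) = - wsum (set xs) v + 2 * cos \<theta> * wsum (- set xs) v"
    using wsum_pair[OF assms(2,3), of v] by (simp add: algebra_simps)
  show "wsum (- set xs) (word xs v) = wsum (- set xs) v"
    unfolding wsum_def by (intro sum.cong refl) (simp add: word_other)
qed

lemma compl: "- set as = set bs" "- set bs = set as"
  using dist all by auto

text \<open>The two colour words reflect the plane in lines that meet at the angle \<theta>; their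
  product is therefore a rotation by 2\<theta>.\<close>

lemma K_reflections:
  "K (word as v) = cis (- \<theta>) * cnj (K v)" "K (word bs v) = cis \<theta> * cnj (K v)"
proof -
  have ct: "cos \<theta> = 2 * (cos (\<theta> / 2))\<^sup>2 - 1" "sin \<theta> = 2 * sin (\<theta> / 2) * cos (\<theta> / 2)"
    using cos_double_cos[of "\<theta> / 2"] sin_double[of "\<theta> / 2"] by simp_all
  have sq: "(sin (\<theta> / 2))\<^sup>2 = 1 - (cos (\<theta> / 2))\<^sup>2" by (simp add: sin_squared_eq)
  have a: "wsum (set as) (word as v) = - wsum (set as) v + 2 * cos \<theta> * wsum (set bs) v"
    "wsum (set bs) (word as v) = wsum (set bs) v"
    using wsum_word[of as v] dist indep by (simp_all add: compl)
  have b: "wsum (set bs) (word bs v) = - wsum (set bs) v + 2 * cos \<theta> * wsum (set as) v"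
    "wsum (set as) (word bs v) = wsum (set as) v"
    using wsum_word[of bs v] dist indep by (simp_all add: compl)
  show "K (word as v) = cis (- \<theta>) * cnj (K v)"
    unfolding K_def a complex_eq_iff by (simp add: ct) (use sq in algebra)
  show "K (word bs v) = cis \<theta> * cnj (K v)"
    unfolding K_def b complex_eq_iff by (simp add: ct) (use sq in algebra)
qed

lemma K_c: "K (c v) = cis (- 2 * \<theta>) * K v"
  by (simp add: c_def K_reflections cis_cnj mult.assoc[symmetric] cis_mult)

lemma K_funpow: "K ((c ^^ n) v) = cis (- 2 * real n * \<theta>) * K v"
proof (induction n)
  case (Suc n)
  have "K ((c ^^ Suc n) v) = cis (- 2 * \<theta>) * (cis (- 2 * real n * \<theta>) * K v)"
    using K_c[of "(c ^^ n) v"] Suc by simp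
  also have "\<dots> = cis (- 2 * \<theta> + - 2 * real n * \<theta>) * K v"
    unfolding cis_mult[symmetric] by (rule mult.assoc[symmetric])
  also have "- 2 * \<theta> + - 2 * real n * \<theta> = - 2 * real (Suc n) * \<theta>"
    by (simp add: algebra_simps)
  finally show ?case .
qed simp

lemma rotation_exists: "\<exists>w\<in>W. \<forall>v. K (w v) = cis (2 * of_int j * \<theta>) * K v"
proof (cases "j \<le> 0")
  case True
  then have "K ((c ^^ nat (- j)) v) = cis (2 * of_int j * \<theta>) * K v" for v
    using K_funpow[of "nat (- j)" v] by simp
  then show ?thesis using funpow_in[OF c_in] by blast
next
  case False
  let ?w = "c ^^ nat j"
  have w: "?w \<in> W" by (intro funpow_in c_in)
  have "K (inv ?w v) = cis (2 * of_int j * \<theta>) * K v" for v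
  proof -
    have "K v = cis (- 2 * real (nat j) * \<theta>) * K (inv ?w v)"
      using K_funpow[of "nat j" "inv ?w v"] inv_apply(2)[OF w, of v] by metis
    then show ?thesis using False by (simp add: mult.assoc[symmetric] cis_mult)
  qed
  then show ?thesis using inv_in[OF w] by blast
qed

lemma sin_pos: "0 < sin (\<theta> / 2)" and cos_pos: "0 < cos (\<theta> / 2)"
  using theta by (auto intro!: sin_gt_zero cos_gt_zero_pi)

text \<open>Both colour sums of a positive root are nonnegative, so their difference is at most
  their sum. The second bound says, without division, that the argument is at most (pi - \<theta>)/2
  in absolute value.\<close>

lemma K_pos_root:
  assumes "b \<in> roots" "pos b"
  shows "0 < Re (K b)" "\<bar>Im (K b)\<bar> * sin (\<theta> / 2) \<le> \<bar>Re (K b)\<bar> * cos (\<theta> / 2)"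
proof -
  let ?X = "wsum (set as) b" and ?Y = "wsum (set bs) b"
  have nn: "0 \<le> ?X" "0 \<le> ?Y"
    using assms(2) p_pos by (auto simp: wsum_def pos_def less_imp_le intro!: sum_nonneg mult_nonneg_nonneg)
  obtain k where k: "b k \<noteq> 0" using root_nonzero[OF assms(1)] by blast
  have "?X + ?Y = (\<Sum>i\<in>UNIV. p i * b i)"
    unfolding wsum_def using sum.subset_diff[of "set as" UNIV "\<lambda>i. p i * b i"] compl
    by (simp add: Compl_eq_Diff_UNIV)
  also have "\<dots> > 0"
    by (rule sum_pos2[of _ k]) (use k assms(2) p_pos in \<open>auto simp: pos_def less_imp_le order_less_le\<close>)
  finally have s: "0 < ?X + ?Y" .
  show "0 < Re (K b)" using s sin_pos by (simp add: K_def)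
  have "\<bar>?X - ?Y\<bar> \<le> \<bar>?X + ?Y\<bar>" using nn by simp
  then have "(cos (\<theta> / 2) * sin (\<theta> / 2)) * \<bar>?X - ?Y\<bar> \<le> (cos (\<theta> / 2) * sin (\<theta> / 2)) * \<bar>?X + ?Y\<bar>"
    using sin_pos cos_pos by (intro mult_left_mono) auto
  then show "\<bar>Im (K b)\<bar> * sin (\<theta> / 2) \<le> \<bar>Re (K b)\<bar> * cos (\<theta> / 2)"
    using sin_pos cos_pos by (simp add: K_def abs_mult mult_ac)
qed

lemma K_minus: "K (\<lambda>k. - v k) = - K v"
  by (simp add: K_def wsum_def sum_negf complex_eq_iff algebra_simps)

lemma K_root:
  assumes "b \<in> roots"
  shows "pos b \<longleftrightarrow> 0 < Re (K b)" "neg b \<longleftrightarrow> Re (K b) < 0" "Re (K b) \<noteq> 0"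
    "\<bar>Im (K b)\<bar> * sin (\<theta> / 2) \<le> \<bar>Re (K b)\<bar> * cos (\<theta> / 2)"
proof -
  have n: "neg b \<Longrightarrow> Re (K b) < 0 \<and> \<bar>Im (K b)\<bar> * sin (\<theta> / 2) \<le> \<bar>Re (K b)\<bar> * cos (\<theta> / 2)"
    using K_pos_root[OF roots_minus[OF assms]] by (simp add: K_minus)
  show "pos b \<longleftrightarrow> 0 < Re (K b)" "neg b \<longleftrightarrow> Re (K b) < 0" "Re (K b) \<noteq> 0"
    "\<bar>Im (K b)\<bar> * sin (\<theta> / 2) \<le> \<bar>Re (K b)\<bar> * cos (\<theta> / 2)"
    using n K_pos_root[OF assms] root_cases[OF assms] by fastforce+
qed

lemma K_simple: "x \<in> set as \<Longrightarrow> K (e x) = of_real (p x) * cis ((pi - \<theta>) / 2)"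
proof -
  assume x: "x \<in> set as"
  then have "wsum (set as) (e x) = p x" "wsum (set bs) (e x) = 0"
    using dist by (auto simp: wsum_def simple_root_apply if_distrib cong: if_cong intro!: sum.neutral)
  then show ?thesis
    by (simp add: K_def complex_eq_iff diff_divide_distrib cos_diff sin_diff)
qed

text \<open>No rotate of a simple root may fall into the gap between the positive and the negative sector.\<close>
lemma cos_gap: "cos ((4 * of_int j - 1) * \<theta>) \<le> cos \<theta>"
proof -
  obtain w where w: "w \<in> W" "\<And>v. K (w v) = cis (2 * of_int j * \<theta>) * K v"
    using rotation_exists by blast
  obtain x where x: "x \<in> set as" using nonempty by (cases as) auto
  let ?d = "(pi - \<theta>) / 2"
  define \<phi> where "\<phi> = 2 * of_int j * \<theta> + ?d"
  have "K (w (e x)) = of_real (p x) * cis \<phi>"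
    by (simp add: w(2) K_simple[OF x] \<phi>_def cis_mult[symmetric])
  then have "\<bar>p x * sin \<phi>\<bar> * sin (\<theta> / 2) \<le> \<bar>p x * cos \<phi>\<bar> * cos (\<theta> / 2)"
    using K_root(4)[OF in_roots[OF w(1)], of x] by simp
  then have "p x * (\<bar>sin \<phi>\<bar> * sin (\<theta> / 2)) \<le> p x * (\<bar>cos \<phi>\<bar> * cos (\<theta> / 2))"
    using p_pos[of x] by (simp add: abs_mult mult_ac)
  then have "\<bar>sin \<phi>\<bar> * sin (\<theta> / 2) \<le> \<bar>cos \<phi>\<bar> * cos (\<theta> / 2)"
    using p_pos[of x] by simp
  \<comment> \<open>Squaring turns the sector condition into a bound on cos(2\<phi>).\<close>
  then have "(\<bar>sin \<phi>\<bar> * sin (\<theta> / 2))\<^sup>2 \<le> (\<bar>cos \<phi>\<bar> * cos (\<theta> / 2))\<^sup>2"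
    using sin_pos by (intro power_mono) auto
  then have "(sin \<phi>)\<^sup>2 * (1 - (cos (\<theta> / 2))\<^sup>2) \<le> (1 - (sin \<phi>)\<^sup>2) * (cos (\<theta> / 2))\<^sup>2"
    unfolding power_mult_distrib power2_abs cos_squared_eq[of \<phi>] sin_squared_eq[of "\<theta> / 2"] .
  then have "(sin \<phi>)\<^sup>2 \<le> (cos (\<theta> / 2))\<^sup>2" by (simp add: algebra_simps)
  then have "cos (2 * \<phi>) \<ge> - cos \<theta>"
    using cos_double_sin[of \<phi>] cos_double_cos[of "\<theta> / 2"] by simp
  moreover have "2 * \<phi> = (4 * of_int j - 1) * \<theta> + pi" by (simp add: \<phi>_def field_simps)
  ultimately show ?thesis by simp
qed

text \<open>Rigidity gives \<theta> = pi/M for some \<open>M\<close>; it remains to see that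
  \<open>M\<close> is the order of \<open>c\<close>.\<close>

lemma order_theta: "elem_order c \<ge> 2 \<and> \<theta> = pi / real (elem_order c)"
proof -
  obtain M :: nat where M: "M \<ge> 2" "\<theta> = pi / real M"
    using angle_rigidity[OF theta cos_gap] by auto
  have "elem_order c = M" unfolding elem_order_def
  proof (rule Least_equality)
    \<comment> \<open>A full turn of the plane keeps all simple roots positive.\<close>
    have "c ^^ M = id"
    proof (rule pos_imp_id)
      fix s
      have turn: "- 2 * real M * \<theta> = - (2 * pi)" using M by simp
      have "K ((c ^^ M) (e s)) = K (e s)" using K_funpow[of M "e s"] unfolding turn
        by (simp add: complex_eq_iff)
      then show "pos ((c ^^ M) (e s))"
        using K_root(1) in_roots[OF funpow_in[OF c_in], of M s] e_in_roots pos_e by metis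
    qed (intro funpow_in c_in)
    then show "0 < M \<and> c ^^ M = id" using M(1) by simp
  next
    fix k assume k: "0 < k \<and> c ^^ k = id"
    show "M \<le> k"
    proof (rule ccontr)
      \<comment> \<open>Here k\<theta> lies strictly between 0 and pi, so the rotation by 2k\<theta>
        moves the nonzero \<open>K (e x)\<close>.\<close>
      assume "\<not> M \<le> k"
      obtain x :: 'i where True by simp
      have "cis (- 2 * real k * \<theta>) * K (e x) = K (e x)" using K_funpow[of k "e x"] k by simp
      moreover have "K (e x) \<noteq> 0" using K_root(3)[OF e_in_roots, of x] by auto
      ultimately have "cis (- 2 * real k * \<theta>) = 1" by simp
      then have "cos (2 * (k * \<theta>)) = 1" by (simp add: complex_eq_iff mult.assoc)
      then have "sin (k * \<theta>) = 0" using cos_double_sin[of "k * \<theta>"] by simp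
      moreover have "0 < k * \<theta>" using k theta by simp
      moreover have "k * \<theta> < real M * \<theta>"
        using \<open>\<not> M \<le> k\<close> theta by (intro mult_strict_right_mono) auto
      then have "k * \<theta> < pi" using M by simp
      ultimately show False using sin_gt_zero[of "k * \<theta>"] by simp
    qed
  qed
  then show ?thesis using M by simp
qed

lemma single_descent:
  assumes "b \<in> roots"
  shows "card {k. k < elem_order c \<and> pos ((c ^^ k) b) \<and> neg ((c ^^ Suc k) b)} = 1"
proof -
  define M where "M = elem_order c"
  have M: "M \<ge> 2" "\<theta> = pi / real M" using order_theta by (simp_all add: M_def)
  \<comment> \<open>Angles are measured in turns; the quarter turn converts the real part, a cosine,
    into a sine.\<close>
  define z where "z = Arg (K b) / (2 * pi) + 1 / 4"
  have nz: "K b \<noteq> 0" using K_root(3)[OF assms] by auto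
  have rt: "(c ^^ k) b \<in> roots" for k using roots_closed[OF funpow_in[OF c_in] assms] .
  have re: "Re (K ((c ^^ k) b)) = norm (K b) * sin (2 * pi * (z - k / M))" for k :: nat
  proof -
    have "K ((c ^^ k) b) = cis (- 2 * real k * \<theta>) * rcis (norm (K b)) (Arg (K b))"
      unfolding K_funpow rcis_cmod_Arg ..
    also have "\<dots> = of_real (norm (K b)) * cis (Arg (K b) - 2 * real k * \<theta>)"
      by (simp add: rcis_def mult.left_commute cis_mult)
    finally have "K ((c ^^ k) b) = of_real (norm (K b)) * cis (Arg (K b) - 2 * real k * \<theta>)" .
    moreover have "2 * pi * (z - k / M) = pi / 2 + (Arg (K b) - 2 * real k * \<theta>)"
      using M by (simp add: z_def field_simps)
    ultimately show ?thesis by (simp add: sin_add)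
  qed
  have "sin (2 * pi * (z - k / M)) \<noteq> 0" for k :: nat using K_root(3)[OF rt[of k]] re[of k] by auto
  from rotation_sign_changes[OF M(1) this]
  show ?thesis unfolding M_def[symmetric] K_root(1)[OF rt] K_root(2)[OF rt] re
    using nz by (simp only: zero_less_mult_iff mult_less_0_iff zero_less_norm_iff norm_not_less_zero simp_thms)
qed

lemma card_stable_roots:
  assumes "R \<subseteq> roots" "finite R" and closed: "\<And>w b. w \<in> W \<Longrightarrow> b \<in> R \<Longrightarrow> w b \<in> R"
  shows "card R = elem_order c * card {i. e i \<in> R}"
proof -
  let ?M = "elem_order c"
  let ?S = "{b \<in> R. pos b \<and> neg (c b)}"
  \<comment> \<open>\<open>c ^^ k\<close> permutes \<open>R\<close>, so the count does not depend on
    \<open>k\<close>.\<close>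
  have sh: "card {b \<in> R. pos ((c ^^ k) b) \<and> neg ((c ^^ Suc k) b)} = card ?S" for k
  proof (rule bij_betw_same_card[of "c ^^ k"], rule bij_betw_byWitness[where f' = "inv (c ^^ k)"])
  qed (use closed[OF funpow_in[OF c_in]] closed[OF inv_in[OF funpow_in[OF c_in]]]
      inv_apply[OF funpow_in[OF c_in]] in auto)
  have "card R = (\<Sum>b\<in>R. card {k \<in> {..<?M}. pos ((c ^^ k) b) \<and> neg ((c ^^ Suc k) b)})"
    using single_descent assms(1) by (simp add: subset_iff)
  also have "\<dots> = (\<Sum>k<?M. card {b \<in> R. pos ((c ^^ k) b) \<and> neg ((c ^^ Suc k) b)})"
    by (rule sum_multicount_gen) (use assms(2) in auto)
  also have "\<dots> = ?M * card ?S" unfolding sh by simp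
  also have "card ?S = card {i \<in> set (as @ bs). e i \<in> R}"
    unfolding c_def by (rule card_inversions[OF dist assms(1,2)]) (rule closed)
  finally show ?thesis unfolding all by simp
qed

end

context finite_coxeter
begin

lemma card_roots_coxeter:
  assumes "distinct ss" "set ss = UNIV"
    and "R \<subseteq> roots" "finite R" "\<And>w b. w \<in> W \<Longrightarrow> b \<in> R \<Longrightarrow> w b \<in> R"
  shows "card R = elem_order (word ss) * card {i. e i \<in> R}"
proof -
  obtain as bs where ab: "distinct (as @ bs)" "set (as @ bs) = UNIV" "as \<noteq> []" "independent (set as)"
    "independent (set bs)" "elem_order (word ss) = elem_order (word (as @ bs))"
    using bipartite_order[OF assms(1,2)] by blast
  obtain p :: "'i \<Rightarrow> real" and \<theta> :: real where "\<And>i. 0 < p i" "0 < \<theta>" "\<theta> \<le> pi / 2"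
    "\<And>i. pair i p = (1 - cos \<theta>) * p i" by (rule perron_vector) (rule that)
  then interpret coxeter_plane m as bs p \<theta> by unfold_locales (use ab in auto)
  have "card R = elem_order c * card {i. e i \<in> R}"
    by (rule card_stable_roots[OF assms(3,4)]) (rule assms(5))
  then show ?thesis using ab(6) by (simp only: c_def)
qed

section \<open>Descents\<close>

definition sg :: "('i \<Rightarrow> real) \<Rightarrow> real" where
  "sg b = (if neg b then -1 else 1)"

lemma sg_minus: "b \<in> roots \<Longrightarrow> sg (\<lambda>k. - b k) = - sg b"
  using root_not_both by (simp add: sg_def)

lemma sg_refl: "b \<in> roots \<Longrightarrow> b \<noteq> e s \<Longrightarrow> b \<noteq> (\<lambda>k. - e s k) \<Longrightarrow> sg (r s b) = sg b"
proof -
  assume b: "b \<in> roots" "b \<noteq> e s" "b \<noteq> (\<lambda>k. - e s k)"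
  have rb: "r s b \<in> roots" using roots_closed[OF refl_in b(1)] .
  show "sg (r s b) = sg b"
  proof (cases "pos b")
    case True
    then show ?thesis using refl_root_pos[OF b(1) True b(2)] root_not_both[OF rb] root_not_both[OF b(1)]
      by (simp add: sg_def)
  next
    case False
    then have n: "neg b" using root_cases[OF b(1)] by blast
    have "(\<lambda>k. - b k) \<noteq> e s"
    proof
      assume "(\<lambda>k. - b k) = e s"
      from fun_cong[OF this] have "b k = - e s k" for k by (metis minus_minus)
      then have "b = (\<lambda>k. - e s k)" by blast
      then show False using b(3) by simp
    qed
    then have "pos (r s (\<lambda>k. - b k))" using refl_root_pos[OF roots_minus[OF b(1)]] n by simp
    then show ?thesis using n lin_minus[OF refl_in] by (simp add: sg_def)
  qed
qed

lemma des_eq: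
  assumes "w \<in> W"
  shows "real (des m w) = (\<Sum>s\<in>UNIV. (1 - sg (w (e s))) / 2)"
proof -
  have "w (e s) \<in> neg_roots m \<longleftrightarrow> neg (w (e s))" for s
    using assms by (auto simp: neg_roots_def neg_def)
  then have "real (des m w) = (\<Sum>s\<in>UNIV. if neg (w (e s)) then 1 else 0)"
    by (simp add: des_def sum.If_cases)
  also have "\<dots> = (\<Sum>s\<in>UNIV. (1 - sg (w (e s))) / 2)"
    by (intro sum.cong) (auto simp: sg_def)
  finally show ?thesis .
qed

lemma sum_sg: "(\<Sum>w\<in>W. sg (w (e s))) = 0"
proof -
  have "(\<Sum>w\<in>W. sg (w (e s))) = (\<Sum>w\<in>W. sg ((w \<circ> r s) (e s)))"
    by (rule sum.reindex_bij_betw[OF bij_betw_comp_refl, symmetric])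
  also have "\<dots> = (\<Sum>w\<in>W. - sg (w (e s)))"
    by (intro sum.cong refl) (simp add: lin_minus sg_minus)
  finally show ?thesis by (simp add: sum_negf)
qed

text \<open>On \<open>?A\<close> the two signs agree and the summand is 1. Off \<open>?A\<close>,
  right multiplication by \<open>r s\<close> is a sign-reversing involution, so the summands
  cancel.\<close>

lemma sum_sg_sg:
  "(\<Sum>w\<in>W. sg (w (e s)) * sg (inv w (e t)))
    = real (card {w \<in> W. w (e s) = e t \<or> w (e s) = (\<lambda>k. - e t k)})" (is "_ = real (card ?A)")
proof -
  let ?f = "\<lambda>w. sg (w (e s)) * sg (inv w (e t))"
  have A: "?f w = 1" if w: "w \<in> ?A" for w
  proof -
    have wt: "w (inv w (e t)) = e t" using w by simp
    have "inv w (e t) = e s \<or> inv w (e t) = (\<lambda>k. - e s k)"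
    proof (cases "w (e s) = e t")
      case False
      then have "e t = (\<lambda>k. - w (e s) k)" using w by auto
      also have "\<dots> = w (\<lambda>k. - e s k)" using w by (simp add: lin_minus)
      finally show ?thesis using w by simp
    qed (use w inv_apply(1)[of w "e s"] in auto)
    moreover have "inv w (e t) = e s \<Longrightarrow> w (e s) = e t" using wt by metis
    moreover have "sg (e x) = 1" for x using root_not_both[of "e x"] by (simp add: sg_def)
    moreover have "inv w (e t) = (\<lambda>k. - e s k) \<Longrightarrow> w (e s) = (\<lambda>k. - e t k)"
    proof -
      assume "inv w (e t) = (\<lambda>k. - e s k)"
      then have "e t = w (\<lambda>k. - e s k)" using wt by metis
      then show "w (e s) = (\<lambda>k. - e t k)" using w by (simp add: lin_minus)
    qed
    ultimately show ?thesis using sg_minus[OF e_in_roots] by auto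
  qed
  have fl: "?f (w \<circ> r s) = - ?f w" if w: "w \<in> W - ?A" for w
  proof -
    have wt: "w (inv w (e t)) = e t" using w by simp
    have "inv w (e t) \<noteq> e s"
    proof
      assume "inv w (e t) = e s"
      then have "w (e s) = e t" using wt by metis
      then show False using w by simp
    qed
    moreover have "inv w (e t) \<noteq> (\<lambda>k. - e s k)"
    proof
      assume "inv w (e t) = (\<lambda>k. - e s k)"
      then have "e t = w (\<lambda>k. - e s k)" using wt by metis
      then show False using w by (simp add: lin_minus)
    qed
    moreover have "inv w (e t) \<in> roots" using w by simp
    ultimately show ?thesis using w by (simp add: inv_comp_refl sg_refl lin_minus sg_minus)
  qed
  have bij: "bij_betw (\<lambda>w. w \<circ> r s) (W - ?A) (W - ?A)"
  proof (rule bij_betw_byWitness[where f' = "\<lambda>w. w \<circ> r s"])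
    have "w \<circ> r s \<in> W - ?A" if "w \<in> W - ?A" for w
    proof -
      have neg_eq: "(\<lambda>k. - f k) = g \<longleftrightarrow> f = (\<lambda>k. - g k)" for f g :: "'i \<Rightarrow> real"
        unfolding fun_eq_iff by (metis minus_minus)
      have "(w \<circ> r s) (e s) = (\<lambda>k. - w (e s) k)" using that by (simp add: lin_minus)
      moreover have "w \<circ> r s \<in> W" using that comp_in[of w "r s"] by simp
      ultimately show ?thesis using that by (simp add: neg_eq)
    qed
    \<comment> \<open>The two inclusions to be shown coincide, because the map is its own
      inverse.\<close>
    then show "(\<lambda>w. w \<circ> r s) ` (W - ?A) \<subseteq> W - ?A" by blast
    then show "(\<lambda>w. w \<circ> r s) ` (W - ?A) \<subseteq> W - ?A" .
  qed (simp_all add: comp_assoc)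
  have "(\<Sum>w\<in>W - ?A. ?f w) = (\<Sum>w\<in>W - ?A. ?f (w \<circ> r s))"
    by (rule sum.reindex_bij_betw[OF bij, symmetric])
  also have "\<dots> = (\<Sum>w\<in>W - ?A. - ?f w)" by (intro sum.cong refl fl)
  finally have z: "(\<Sum>w\<in>W - ?A. ?f w) = 0" by (simp add: sum_negf)
  have "(\<Sum>w\<in>W. ?f w) = (\<Sum>w\<in>W - ?A. ?f w) + (\<Sum>w\<in>?A. ?f w)"
    by (rule sum.subset_diff) (use fin in auto)
  also have "(\<Sum>w\<in>?A. ?f w) = (\<Sum>w\<in>?A. 1)" by (intro sum.cong refl A)
  finally show ?thesis using z by simp
qed

section \<open>Orbit counting for a simple root\<close>

lemma card_fiber:
  assumes v: "v \<in> W"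
  shows "card {w \<in> W. w (e s) = v (e s)} = card {w \<in> W. w (e s) = e s}"
proof (rule bij_betw_same_card[of "\<lambda>w. inv v \<circ> w"],
    rule bij_betw_byWitness[where f' = "\<lambda>w. v \<circ> w"])
  show "(\<lambda>w. inv v \<circ> w) ` {w \<in> W. w (e s) = v (e s)} \<subseteq> {w \<in> W. w (e s) = e s}"
    using v comp_in[OF inv_in[OF v]] by auto
  show "(\<lambda>w. v \<circ> w) ` {w \<in> W. w (e s) = e s} \<subseteq> {w \<in> W. w (e s) = v (e s)}"
    using comp_in[OF v] by auto
qed (use v in \<open>simp_all add: fun_eq_iff\<close>)

text \<open>Fibres over the orbit \<open>R\<close> are cosets of the stabiliser, so
  \<open>card W = card R * f\<close>. With \<open>e t\<close> its negative also lies in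
  \<open>R\<close>, whence the factor 2; \<open>card_roots_coxeter\<close> converts simple roots of
  \<open>R\<close> into all of \<open>R\<close>.\<close>

lemma sum_card_fibers:
  assumes "distinct ss" "set ss = UNIV"
  shows "real (elem_order (word ss)) *
    (\<Sum>t\<in>UNIV. real (card {w \<in> W. w (e s) = e t \<or> w (e s) = (\<lambda>k. - e t k)})) = 2 * card W"
proof -
  define R where "R = (\<lambda>w. w (e s)) ` W"
  define f where "f = card {w \<in> W. w (e s) = e s}"
  have R: "R \<subseteq> roots" "finite R"
    using fin by (auto simp: R_def)
  have closed: "w b \<in> R" if w: "w \<in> W" and b: "b \<in> R" for w b
  proof -
    obtain u where "u \<in> W" "b = u (e s)" using b by (auto simp: R_def)
    then show ?thesis unfolding R_def using comp_in[OF w, of u]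
      by (intro image_eqI[of _ _ "w \<circ> u"]) simp_all
  qed
  have fib: "card {w \<in> W. w (e s) = b} = (if b \<in> R then f else 0)" for b
  proof (cases "b \<in> R")
    case True
    then show ?thesis using card_fiber by (auto simp: R_def f_def)
  next
    case False
    then have "{w \<in> W. w (e s) = b} = {}" by (auto simp: R_def)
    then have "card {w \<in> W. w (e s) = b} = 0" by (simp only: card.empty)
    then show ?thesis using False by simp
  qed
  have "card W = (\<Sum>b\<in>R. card {w \<in> W. w (e s) = b})"
    using card_eq_sum sum.image_gen[OF fin, of "\<lambda>_. 1 :: nat" "\<lambda>w. w (e s)"] by (simp add: R_def)
  then have cW: "card W = card R * f" using fib by simp
  have mem: "(\<lambda>k. - e t k) \<in> R \<longleftrightarrow> e t \<in> R" for t
    using closed[OF refl_in, of "e t" t] closed[OF refl_in, of "\<lambda>k. - e t k" t] by (auto simp: lin_minus)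
  have "card {w \<in> W. w (e s) = e t \<or> w (e s) = (\<lambda>k. - e t k)} = (if e t \<in> R then 2 * f else 0)" for t
  proof -
    have "e t \<noteq> (\<lambda>k. - e t k)" by (auto simp: fun_eq_iff simple_root_apply intro!: exI[of _ t])
    moreover have "{w \<in> W. w (e s) = e t \<or> w (e s) = (\<lambda>k. - e t k)}
        = {w \<in> W. w (e s) = e t} \<union> {w \<in> W. w (e s) = (\<lambda>k. - e t k)}" by auto
    ultimately have "card {w \<in> W. w (e s) = e t \<or> w (e s) = (\<lambda>k. - e t k)}
        = card {w \<in> W. w (e s) = e t} + card {w \<in> W. w (e s) = (\<lambda>k. - e t k)}"
      using fin by (simp only:) (rule card_Un_disjoint; auto)
    then show ?thesis by (simp add: fib mem)
  qed
  then have "(\<Sum>t\<in>UNIV. card {w \<in> W. w (e s) = e t \<or> w (e s) = (\<lambda>k. - e t k)})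
      = 2 * f * card {t. e t \<in> R}"
    by (simp add: sum.If_cases)
  then have "elem_order (word ss) * (\<Sum>t\<in>UNIV. card {w \<in> W. w (e s) = e t \<or> w (e s) = (\<lambda>k. - e t k)})
      = 2 * f * (elem_order (word ss) * card {t. e t \<in> R})"
    by simp
  also have "elem_order (word ss) * card {t. e t \<in> R} = card R"
    by (rule card_roots_coxeter[OF assms R(1,2), symmetric]) (rule closed)
  finally have "elem_order (word ss) * (\<Sum>t\<in>UNIV. card {w \<in> W. w (e s) = e t \<or> w (e s) = (\<lambda>k. - e t k)})
      = 2 * card W" unfolding cW by simp
  then show ?thesis unfolding of_nat_sum[symmetric] of_nat_mult[symmetric] by (simp only: of_nat_mult)
qed

section \<open>Mean and variance\<close>

lemma des_moments:
  assumes "distinct ss" "set ss = UNIV"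
  defines "n \<equiv> card (UNIV :: 'i set)" and "h \<equiv> elem_order (word ss)"
  shows "unif_mean W (\<lambda>w. real (des m w + des m (inv w))) = real n"
    and "unif_var W (\<lambda>w. real (des m w + des m (inv w)))
      = 2 * unif_var W (\<lambda>w. real (des m w)) + real n / real h"
proof -
  \<comment> \<open>On \<open>W\<close> this is n - 2 des, which has mean zero.\<close>
  define D where "D w = (\<Sum>s\<in>UNIV. sg (w (e s)))" for w
  define N where "N = real (card W)"
  have N: "N > 0" unfolding N_def using fin cox_group.id[of m] by (auto simp: card_gt_0_iff)
  have des: "real (des m w) = n / 2 - D w / 2" if "w \<in> W" for w
    unfolding des_eq[OF that] D_def n_def
    by (simp add: diff_divide_distrib sum_subtractf sum_divide_distrib)
  have both: "real (des m w + des m (inv w)) = n - (D w + D (inv w)) / 2" if "w \<in> W" for w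
    using des[OF that] des[OF inv_in[OF that]] by (simp add: field_simps)
  have SD: "(\<Sum>w\<in>W. D w) = 0"
    unfolding D_def by (subst sum.swap) (simp add: sum_sg)
  have inv_sum: "(\<Sum>w\<in>W. g (inv w)) = (\<Sum>w\<in>W. g w)" for g :: "_ \<Rightarrow> real"
    by (rule sum.reindex_bij_betw[OF bij_betw_inv])
  have mean: "unif_mean W (\<lambda>w. real (des m w + des m (inv w))) = n"
  proof -
    have "(\<Sum>w\<in>W. real (des m w + des m (inv w))) = (\<Sum>w\<in>W. n - (D w + D (inv w)) / 2)"
      by (intro sum.cong refl both)
    also have "\<dots> = N * n" using inv_sum[of D] SD
      by (simp add: sum_subtractf sum.distrib sum_divide_distrib[symmetric] N_def)
    finally show ?thesis using N by (simp add: unif_mean_def N_def[symmetric])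
  qed
  have mean1: "unif_mean W (\<lambda>w. real (des m w)) = n / 2"
  proof -
    have "(\<Sum>w\<in>W. real (des m w)) = (\<Sum>w\<in>W. n / 2 - D w / 2)"
      by (intro sum.cong refl des)
    also have "\<dots> = N * (n / 2)" using SD
      by (simp add: sum_subtractf sum_divide_distrib[symmetric] N_def)
    finally show ?thesis using N by (simp add: unif_mean_def N_def[symmetric])
  qed
  \<comment> \<open>The covariance before normalisation; each simple root \<open>s\<close>
    contributes \<open>2 * N\<close>.\<close>
  have cross: "h * (\<Sum>w\<in>W. D w * D (inv w)) = 2 * n * N"
  proof -
    define T where
      "T s = (\<Sum>t\<in>UNIV. real (card {w \<in> W. w (e s) = e t \<or> w (e s) = (\<lambda>k. - e t k)}))" for s
    have "(\<Sum>w\<in>W. D w * D (inv w)) = (\<Sum>w\<in>W. \<Sum>s\<in>UNIV. \<Sum>t\<in>UNIV. sg (w (e s)) * sg (inv w (e t)))"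
      by (simp add: D_def sum_product)
    also have "\<dots> = (\<Sum>s\<in>UNIV. \<Sum>t\<in>UNIV. \<Sum>w\<in>W. sg (w (e s)) * sg (inv w (e t)))"
      by (subst sum.swap, intro sum.cong refl, subst sum.swap, rule refl)
    also have "\<dots> = (\<Sum>s\<in>UNIV. T s)" unfolding T_def sum_sg_sg ..
    finally have "h * (\<Sum>w\<in>W. D w * D (inv w)) = (\<Sum>s\<in>UNIV. h * T s)" by (simp add: sum_distrib_left)
    also have "\<dots> = (\<Sum>s\<in>(UNIV :: 'i set). 2 * N)"
      using sum_card_fibers[OF assms(1,2)] by (simp add: T_def h_def N_def)
    finally show ?thesis by (simp add: n_def)
  qed
  \<comment> \<open>Read off from \<open>cross\<close>, whose right side is positive.\<close>
  have h: "real h \<noteq> 0" 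
  proof
    assume "real h = 0"
    then have "2 * real n * N = 0" using cross by simp
    then show False using N by (simp add: n_def)
  qed
  have v1: "unif_var W (\<lambda>w. real (des m w)) = (\<Sum>w\<in>W. (D w)\<^sup>2) / (4 * N)"
  proof -
    have "(\<Sum>w\<in>W. (real (des m w) - n / 2)\<^sup>2) = (\<Sum>w\<in>W. (D w)\<^sup>2 / 4)"
      by (intro sum.cong refl) (simp add: des power_divide)
    also have "\<dots> = (\<Sum>w\<in>W. (D w)\<^sup>2) / 4" by (rule sum_divide_distrib[symmetric])
    finally have sq: "(\<Sum>w\<in>W. (real (des m w) - n / 2)\<^sup>2) = (\<Sum>w\<in>W. (D w)\<^sup>2) / 4" .
    show ?thesis unfolding unif_var_def mean1 sq N_def by simp
  qed
  have "(\<Sum>w\<in>W. (real (des m w + des m (inv w)) - n)\<^sup>2)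
      = (\<Sum>w\<in>W. (D w)\<^sup>2 / 4 + (D (inv w))\<^sup>2 / 4 + D w * D (inv w) / 2)"
    by (intro sum.cong refl, subst both) (simp_all add: power2_eq_square field_simps)
  also have "\<dots> = (\<Sum>w\<in>W. (D w)\<^sup>2) / 2 + (\<Sum>w\<in>W. D w * D (inv w)) / 2"
    using inv_sum[of "\<lambda>w. (D w)\<^sup>2 / 4"] by (simp add: sum.distrib sum_divide_distrib[symmetric])
  finally have "unif_var W (\<lambda>w. real (des m w + des m (inv w)))
      = 2 * unif_var W (\<lambda>w. real (des m w)) + (\<Sum>w\<in>W. D w * D (inv w)) / (2 * N)"
    unfolding unif_var_def[of W "\<lambda>w. real (des m w + des m (inv w))"] mean v1 N_def[symmetric]
    by (simp add: add_divide_distrib)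
  also have "(\<Sum>w\<in>W. D w * D (inv w)) / (2 * N) = n / h"
    using cross N h by (simp add: field_simps)
  finally show "unif_var W (\<lambda>w. real (des m w + des m (inv w)))
      = 2 * unif_var W (\<lambda>w. real (des m w)) + real n / real h" .
  show "unif_mean W (\<lambda>w. real (des m w + des m (inv w))) = real n" by (rule mean)
qed

end

theorem theorem5p1:
  fixes m :: "'i::finite \<Rightarrow> 'i \<Rightarrow> nat" and ss :: "'i list"
  assumes "coxeter_matrix m"
    and "cox_irreducible m"
    and "finite (cox_group m)"
    and "distinct ss" and "set ss = UNIV"
  defines "n \<equiv> card (UNIV :: 'i set)"
    and "h \<equiv> elem_order (cox_element m ss)"
  shows "unif_mean (cox_group m) (\<lambda>w. real (des m w + des m (inv w))) = real n \<and>
         unif_var (cox_group m) (\<lambda>w. real (des m w + des m (inv w)))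
           = 2 * unif_var (cox_group m) (\<lambda>w. real (des m w)) + real n / real h"
proof -
  interpret finite_coxeter m by unfold_locales (fact assms)+
  show ?thesis using des_moments[OF assms(4,5)] by (simp only: n_def h_def)
qed

end
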